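(* Let $d\ge1$ and let $P\in L(\mathbb{R}^d)$ be a Lie polynomial of degree $m\ge 2$. Then there is no rectifiable path $\gamma:[t_0,t_1]\to\mathbb{R}^d$ (for any real $t_0<t_1$) with $\operatorname{logSig}(\gamma)=P$.
   Context: A path $\gamma:[t_0,t_1]\to\mathbb{R}^d$ is rectifiable if it is continuous and of bounded variation. Let $T((\mathbb{R}^d))=\prod_{k\ge 0}(\mathbb{R}^d)^{\otimes k}$ be the algebra of tensor series over $\mathbb{R}^d$ with product $\otimes$, and let $\pi_k$ be the projection onto $(\mathbb{R}^d)^{\otimes k}$. Signature: for a rectifiable path $\gamma:[t_0,t_1]\to\mathbb{R}^d$, $\operatorname{Sig}(\gamma):=\mathbf{S}(t_1)\in T((\mathbb{R}^d))$, where $\mathbf{S}$ solves $d\mathbf{S}=\mathbf{S}\otimes d\gamma$, $\mathbf{S}(t_0)=1$. Equivalently, $\pi_0(\operatorname{Sig}(\gamma))=1$ and, for $k\ge1$, the coefficient of $\pi_k(\operatorname{Sig}(\gamma))$ at position $(i_1,\dots,i_k)$ is the iterated Riemann–Stieltjes integral $\int_{t_0<s_1<\cdots<s_k<t_1} d\gamma_{i_1}(s_1)\cdots d\gamma_{i_k}(s_k)$. Log-signature: $\operatorname{logSig}(\gamma):=\log(\operatorname{Sig}(\gamma))$, where $\log(1+S)=\sum_{k\ge1}\frac{(-1)^{k-1}}{k}S^{\otimes k}$ for $S$ with zero constant term. With the bracket $[v,w]=v\otimes w-w\otimes v$, the space of Lie series $L((\mathbb{R}^d))\subset T((\mathbb{R}^d))$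 consists of the tensor series whose level-$0$ component is $0$ and whose level-$k$ component, for every $k\ge 1$, is a linear combination of $k$-fold iterated brackets of elements of $\mathbb{R}^d$. A Lie polynomial is a Lie series with only finitely many non-zero homogeneous components; $L(\mathbb{R}^d)$ denotes the space of Lie polynomials. The degree of a non-zero Lie polynomial $P$ is the largest $k$ with $\pi_k(P)\ne0$. *)

theory Defs
  imports "HOL-Analysis.Analysis"
begin

section \<open>Tensor series\<close>

text \<open>
  A tensor series over \<open>real ^ 'd\<close> is given by its coefficients: the entry of its level-\<open>k\<close>
  component at position \<open>(i\<^sub>1, \<dots>, i\<^sub>k)\<close> is the coefficient at the word \<open>[i\<^sub>1, \<dots>, i\<^sub>k]\<close>, and the
  constant term is the coefficient at \<open>[]\<close>.  In these coordinates the tensor product is the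
  concatenation product.
\<close>

typedef 'd tensor_series = "UNIV :: ('d list \<Rightarrow> real) set"
  morphisms tcoeff Tensor_series ..

lemma tcoeff_Tensor_series [simp]: "tcoeff (Tensor_series f) = f"
  by (simp add: Tensor_series_inverse)

lemma tensor_series_eqI: "(\<And>w. tcoeff x w = tcoeff y w) \<Longrightarrow> x = y"
  by (metis ext tcoeff_inject)

instantiation tensor_series :: (type) real_algebra_1
begin

definition zero_tensor_series :: "'a tensor_series"
  where "0 = Tensor_series (\<lambda>w. 0)"

definition one_tensor_series :: "'a tensor_series"
  where "1 = Tensor_series (\<lambda>w. if w = [] then 1 else 0)"

definition plus_tensor_series :: "'a tensor_series \<Rightarrow> 'a tensor_series \<Rightarrow> 'a tensor_series"
  where "x + y = Tensor_series (\<lambda>w. tcoeff x w + tcoeff y w)"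

definition minus_tensor_series :: "'a tensor_series \<Rightarrow> 'a tensor_series \<Rightarrow> 'a tensor_series"
  where "x - y = Tensor_series (\<lambda>w. tcoeff x w - tcoeff y w)"

definition uminus_tensor_series :: "'a tensor_series \<Rightarrow> 'a tensor_series"
  where "- x = Tensor_series (\<lambda>w. - tcoeff x w)"

definition scaleR_tensor_series :: "real \<Rightarrow> 'a tensor_series \<Rightarrow> 'a tensor_series"
  where "c *\<^sub>R x = Tensor_series (\<lambda>w. c * tcoeff x w)"

definition times_tensor_series :: "'a tensor_series \<Rightarrow> 'a tensor_series \<Rightarrow> 'a tensor_series"
  where "x * y =
    Tensor_series (\<lambda>w. \<Sum>n\<le>length w. tcoeff x (take n w) * tcoeff y (drop n w))"

lemmas tensor_series_defs = zero_tensor_series_def one_tensor_series_def plus_tensor_series_def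
  minus_tensor_series_def uminus_tensor_series_def scaleR_tensor_series_def
  times_tensor_series_def

instance
proof
  fix x y z :: "'a tensor_series" and a b :: real
  show "x * y * z = x * (y * z)"
  proof (rule tensor_series_eqI)
    fix w :: "'a list"
    define f where "f i j k = tcoeff x (take i w) * tcoeff y (take j (drop i w))
      * tcoeff z (drop (i + j) w)" for i j k :: nat
    have "tcoeff (x * y * z) w = (\<Sum>j = 0..length w. \<Sum>i = 0..j. f i (j - i) (length w - j))"
      by (auto simp: times_tensor_series_def f_def sum_distrib_right min_def drop_take
          atMost_atLeast0 intro!: sum.cong split: if_splits)
    also have "\<dots> = (\<Sum>j = 0..length w. \<Sum>i = 0..length w - j. f j i (length w - j - i))"
      by (rule fps_mult_assoc_lemma)
    also have "\<dots> = tcoeff (x * (y * z)) w"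
      by (auto simp: times_tensor_series_def f_def sum_distrib_left atMost_atLeast0
          mult.assoc add.commute intro!: sum.cong)
    finally show "tcoeff (x * y * z) w = tcoeff (x * (y * z)) w" .
  qed
  show "1 * x = x"
  proof (rule tensor_series_eqI)
    fix w :: "'a list"
    have "tcoeff (1 * x) w
        = (\<Sum>n\<le>length w. if n = 0 then tcoeff x w else 0)"
      unfolding tensor_series_defs tcoeff_Tensor_series by (rule sum.cong) auto
    then show "tcoeff (1 * x) w = tcoeff x w" by simp
  qed
  show "x * 1 = x"
  proof (rule tensor_series_eqI)
    fix w :: "'a list"
    have "tcoeff (x * 1) w
        = (\<Sum>n\<le>length w. if n = length w then tcoeff x w else 0)"
      unfolding tensor_series_defs tcoeff_Tensor_series by (rule sum.cong) auto
    then show "tcoeff (x * 1) w = tcoeff x w" by simp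
  qed
  show "(0 :: 'a tensor_series) \<noteq> 1"
    by (auto simp: tensor_series_defs Tensor_series_inject fun_eq_iff)
qed (auto intro!: tensor_series_eqI sum.cong simp: tensor_series_defs algebra_simps
      sum.distrib sum_distrib_left)

end

definition level :: "nat \<Rightarrow> 'd tensor_series \<Rightarrow> 'd tensor_series"
  where "level k x = Tensor_series (\<lambda>w. if length w = k then tcoeff x w else 0)"

text \<open>
  \<open>tensor_log (1 + S)\<close> is the usual power series, summed coefficientwise; it is meaningful for
  \<open>S\<close> with zero constant term, where at each word only finitely many summands are non-zero
  (see \<open>tcoeff_power_eq_0\<close>).  The summation index is shifted by one.
\<close>

definition tensor_log :: "'d tensor_series \<Rightarrow> 'd tensor_series"
  where "tensor_log X = Tensor_series
    (\<lambda>w. \<Sum>k. tcoeff (((- 1) ^ k / real (Suc k)) *\<^sub>R (X - 1) ^ Suc k) w)"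

lemma tcoeff_power_eq_0:
  assumes "tcoeff S [] = 0" and "length w < k"
  shows "tcoeff (S ^ k) w = 0"
  using assms(2)
proof (induction k arbitrary: w)
  case (Suc k)
  have "tcoeff S (take n w) * tcoeff (S ^ k) (drop n w) = 0" if "n \<le> length w" for n
  proof (cases "n = 0")
    case False
    then have "length (drop n w) < k" using that Suc.prems by simp
    then show ?thesis using Suc.IH by simp
  qed (simp add: assms(1))
  then show ?case by (auto simp: times_tensor_series_def intro!: sum.neutral)
qed simp


section \<open>Lie series and Lie polynomials\<close>

definition tensor_of_vec :: "real ^ 'd \<Rightarrow> 'd tensor_series"
  where "tensor_of_vec v = Tensor_series (\<lambda>w. case w of [i] \<Rightarrow> v $ i | _ \<Rightarrow> 0)"

definition lie_bracket :: "'d tensor_series \<Rightarrow> 'd tensor_series \<Rightarrow> 'd tensor_series"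
  where "lie_bracket x y = x * y - y * x"

text \<open>
  \<open>iterated_brackets k\<close> is the set of all \<open>[v\<^sub>1, [v\<^sub>2, \<dots>, [v\<^bsub>k-1\<^esub>, v\<^sub>k] \<dots>]]\<close> with vectors
  \<open>v\<^sub>1, \<dots>, v\<^sub>k\<close>; for \<open>k = 1\<close> these are the vectors themselves.
\<close>

fun iterated_brackets :: "nat \<Rightarrow> ('d::finite) tensor_series set"
  where
    "iterated_brackets 0 = {}"
  | "iterated_brackets (Suc 0) = range tensor_of_vec"
  | "iterated_brackets (Suc (Suc k)) =
      {lie_bracket (tensor_of_vec v) x | v x. x \<in> iterated_brackets (Suc k)}"

definition lie_series :: "('d::finite) tensor_series set"
  where "lie_series = {P. level 0 P = 0 \<and> (\<forall>k\<ge>1. level k P \<in> span (iterated_brackets k))}"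

definition lie_polynomials :: "('d::finite) tensor_series set"
  where "lie_polynomials = {P \<in> lie_series. finite {k. level k P \<noteq> 0}}"

text \<open>Meaningful for non-zero Lie polynomials only.\<close>

definition tensor_degree :: "'d tensor_series \<Rightarrow> nat"
  where "tensor_degree P = Max {k. level k P \<noteq> 0}"


section \<open>Rectifiable paths and Riemann--Stieltjes integrals\<close>

definition bounded_variation_on :: "real \<Rightarrow> real \<Rightarrow> (real \<Rightarrow> 'a::real_normed_vector) \<Rightarrow> bool"
  where "bounded_variation_on a b f \<longleftrightarrow>
    (\<exists>B. \<forall>D. D division_of {a..b} \<longrightarrow> (\<Sum>K\<in>D. norm (f (Sup K) - f (Inf K))) \<le> B)"

definition rectifiable_on :: "real \<Rightarrow> real \<Rightarrow> (real \<Rightarrow> 'a::real_normed_vector) \<Rightarrow> bool"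
  where "rectifiable_on a b f \<longleftrightarrow> continuous_on {a..b} f \<and> bounded_variation_on a b f"

text \<open>
  The Riemann--Stieltjes integral of \<open>f\<close> with respect to \<open>g\<close> over \<open>[a, b]\<close> as the limit of
  Riemann--Stieltjes sums when the mesh tends to zero: the constant-radius gauge
  \<open>\<lambda>x. ball x \<delta>\<close> forces the mesh below \<open>2 * \<delta>\<close>, and admits every mesh below \<open>\<delta>\<close>.
\<close>

definition has_rs_integral ::
    "(real \<Rightarrow> real) \<Rightarrow> (real \<Rightarrow> real) \<Rightarrow> real \<Rightarrow> real \<Rightarrow> real \<Rightarrow> bool"
  where "has_rs_integral f g a b I \<longleftrightarrow>
    (\<forall>\<epsilon>>0. \<exists>\<delta>>0. \<forall>p. p tagged_division_of {a..b} \<and> (\<lambda>x. ball x \<delta>) fine p \<longrightarrow>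
      \<bar>(\<Sum>(x, K)\<in>p. f x * (g (Sup K) - g (Inf K))) - I\<bar> < \<epsilon>)"

definition rs_integral :: "(real \<Rightarrow> real) \<Rightarrow> (real \<Rightarrow> real) \<Rightarrow> real \<Rightarrow> real \<Rightarrow> real"
  where "rs_integral f g a b = (THE I. has_rs_integral f g a b I)"

lemma has_rs_integral_unique:
  assumes I: "has_rs_integral f g a b I" and J: "has_rs_integral f g a b J"
  shows "I = J"
proof (rule ccontr)
  assume "I \<noteq> J"
  define e where "e = \<bar>I - J\<bar> / 2"
  have "e > 0" using \<open>I \<noteq> J\<close> by (simp add: e_def)
  let ?S = "\<lambda>p. \<Sum>(x, K)\<in>p. f x * (g (Sup K) - g (Inf K))"
  obtain d1 where d1: "d1 > 0"
      "\<And>p. p tagged_division_of {a..b} \<Longrightarrow> (\<lambda>x. ball x d1) fine p \<Longrightarrow> \<bar>?S p - I\<bar> < e"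
    using I \<open>e > 0\<close> unfolding has_rs_integral_def by meson
  obtain d2 where d2: "d2 > 0"
      "\<And>p. p tagged_division_of {a..b} \<Longrightarrow> (\<lambda>x. ball x d2) fine p \<Longrightarrow> \<bar>?S p - J\<bar> < e"
    using J \<open>e > 0\<close> unfolding has_rs_integral_def by meson
  obtain p where p: "p tagged_division_of {a..b}" "(\<lambda>x. ball x (min d1 d2)) fine p"
    using fine_division_exists_real[OF gauge_ball[of "min d1 d2"]] d1(1) d2(1)
    by (metis min_less_iff_conj)
  have "(\<lambda>x. ball x d1) fine p" "(\<lambda>x. ball x d2) fine p"
    using p(2) unfolding fine_def by fastforce+
  then have "\<bar>?S p - I\<bar> < e" "\<bar>?S p - J\<bar> < e"
    using d1(2) d2(2) p(1) by auto
  moreover have "\<bar>s - I\<bar> < e \<Longrightarrow> \<bar>s - J\<bar> < e \<Longrightarrow> False" for s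
    using e_def by (smt (verit) field_sum_of_halves)
  ultimately show False by blast
qed

lemma rs_integral_eqI: "has_rs_integral f g a b I \<Longrightarrow> rs_integral f g a b = I"
  unfolding rs_integral_def using has_rs_integral_unique by blast


section \<open>Signature and log-signature\<close>

text \<open>
  The equation \<open>dS = S \<otimes> d\<gamma>\<close>, \<open>S(a) = 1\<close>, coordinate by coordinate: the coefficient of \<open>S(t)\<close> at
  \<open>[i\<^sub>1, \<dots>, i\<^sub>k]\<close> is the integral over \<open>[a, t]\<close> of the one at \<open>[i\<^sub>1, \<dots>, i\<^bsub>k-1\<^esub>]\<close> with respect to the
  \<open>i\<^sub>k\<close>-th coordinate of \<open>\<gamma>\<close>, that is, the iterated integral over \<open>a < s\<^sub>1 < \<dots> < s\<^sub>k < t\<close>.  The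
  recursion removes the last letter, so the word is passed reversed.
\<close>

primrec iterated_integral :: "(real \<Rightarrow> real ^ 'd) \<Rightarrow> real \<Rightarrow> 'd list \<Rightarrow> real \<Rightarrow> real"
  where
    "iterated_integral \<gamma> a [] t = 1"
  | "iterated_integral \<gamma> a (i # w) t = rs_integral (iterated_integral \<gamma> a w) (\<lambda>s. \<gamma> s $ i) a t"

definition signature :: "real \<Rightarrow> real \<Rightarrow> (real \<Rightarrow> real ^ 'd) \<Rightarrow> 'd tensor_series"
  where "signature a b \<gamma> = Tensor_series (\<lambda>w. iterated_integral \<gamma> a (rev w) b)"

definition log_signature :: "real \<Rightarrow> real \<Rightarrow> (real \<Rightarrow> real ^ 'd) \<Rightarrow> 'd tensor_series"
  where "log_signature a b \<gamma> = tensor_log (signature a b \<gamma>)"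

end

theory Submission
  imports Defs
begin

text \<open>
  The signature of a rectifiable path grows too slowly to be the exponential of a polynomial of
  degree at least two.  If \<open>L\<close> is the length of \<open>\<gamma>\<close>, the coefficient of the signature at a word of
  length \<open>n\<close> is at most \<open>L\<^sup>n / n!\<close> (\<open>signature_bound\<close>).  Hence a matrix representation in
  which every letter carries a factor \<open>\<lambda>\<close> turns the signature into a matrix of size
  \<open>exp (O(\<lambda>))\<close>.  On the other hand the signature is the exponential of its logarithm \<open>P\<close>
  (\<open>tcoeff_eq_exp_tensor_log\<close>), and if \<open>P\<close> has degree \<open>m\<close>, the same representation turns it
  into a matrix of size \<open>exp (\<theta> \<lambda>\<^sup>m)\<close> with \<open>\<theta> > 0\<close>, as soon as the image of the top component of
  \<open>P\<close> has a positive eigenvalue.  For \<open>m \<ge> 2\<close> and large \<open>\<lambda>\<close> the two estimates are incompatible.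

  The representation comes from a word \<open>u\<close> of length \<open>m\<close> at which \<open>P\<close> has a non-zero coefficient.
  Write the letters of \<open>u\<close> on the edges of a directed cycle with states \<open>0, \<dots>, m - 1\<close> and
  let a letter act by moving along the edge that carries it, with weight \<open>\<lambda>\<close>.  A word of length \<open>m\<close>
  leads around the whole cycle, so the top component of \<open>P\<close> acts by a diagonal matrix: its entries
  are \<open>\<lambda>\<^sup>m\<close> times the coefficients of \<open>P\<close> at the rotations of \<open>u\<close>, and the entry at state \<open>0\<close> is not zero.
  It becomes positive after one edge of the cycle is given the sign of this coefficient.  The lower
  components of \<open>P\<close> contribute only \<open>O(\<lambda>\<^bsup>m-1\<^esup>)\<close>.

  That the exponential \<open>exp M\<close> of such a perturbed diagonal matrix is large is shown without spectral
  theory: \<open>x(t) = e\<^sub>0 exp (t M)\<close> solves \<open>x' = x M\<close>, and the indefinite quadratic form that is positive on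
  the states whose diagonal entry exceeds \<open>\<theta> \<lambda>\<^sup>m\<close> and negative on the others grows at least like
  \<open>exp (2 \<theta> \<lambda>\<^sup>m t)\<close> along solutions (\<open>linear_ode_growth\<close>).
\<close>

section \<open>Riemann--Stieltjes integrals against paths of bounded variation\<close>

text \<open>
  The model for \<open>V\<close> is the variation function of \<open>g\<close>.  Bounding increments of \<open>g\<close> by increments of a
  single function makes sums over a division telescope.
\<close>
definition increments_dominated :: "real \<Rightarrow> real \<Rightarrow> (real \<Rightarrow> real) \<Rightarrow> (real \<Rightarrow> real) \<Rightarrow> bool"
  where "increments_dominated a b g V \<longleftrightarrow>
    (\<forall>s t. a \<le> s \<longrightarrow> s \<le> t \<longrightarrow> t \<le> b \<longrightarrow> \<bar>g t - g s\<bar> \<le> V t - V s)"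

lemma increments_dominatedD:
  "increments_dominated a b g V \<Longrightarrow> a \<le> s \<Longrightarrow> s \<le> t \<Longrightarrow> t \<le> b \<Longrightarrow> \<bar>g t - g s\<bar> \<le> V t - V s"
  by (simp add: increments_dominated_def)

lemma increments_dominated_mono:
  "increments_dominated a b g V \<Longrightarrow> a \<le> s \<Longrightarrow> s \<le> t \<Longrightarrow> t \<le> b \<Longrightarrow> V s \<le> V t"
  by (smt (verit) increments_dominatedD)

lemma increments_dominated_subinterval:
  "increments_dominated a b g V \<Longrightarrow> a \<le> c \<Longrightarrow> d \<le> b \<Longrightarrow> increments_dominated c d g V"
  by (simp add: increments_dominated_def)

definition rs_sum :: "(real \<Rightarrow> real) \<Rightarrow> (real \<Rightarrow> real) \<Rightarrow> (real \<times> real set) set \<Rightarrow> real"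
  where "rs_sum f g p = (\<Sum>(x, K)\<in>p. f x * (g (Sup K) - g (Inf K)))"

lemma tagged_division_intervalD:
  assumes "p tagged_division_of {a..b::real}" and "(x, K) \<in> p"
  shows "K = {Inf K..Sup K}" "Inf K \<le> x" "x \<le> Sup K" "a \<le> Inf K" "Sup K \<le> b"
proof -
  obtain l r where K: "K = cbox l r" using tagged_division_ofD(4)[OF assms] by blast
  have x: "x \<in> K" and sub: "K \<subseteq> {a..b}" using tagged_division_ofD(2,3)[OF assms] by auto
  have "l \<le> r" using x K by auto
  then have IS: "Inf K = l" "Sup K = r" by (simp_all add: K)
  show "K = {Inf K..Sup K}" "Inf K \<le> x" "x \<le> Sup K" using x K by (simp_all add: IS)
  show "a \<le> Inf K" "Sup K \<le> b" using sub \<open>l \<le> r\<close> unfolding IS by (auto simp: K)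
qed

lemma sum_increments:
  assumes "a \<le> b" and "p tagged_division_of {a..b::real}"
  shows "(\<Sum>(x, K)\<in>p. V (Sup K) - V (Inf K)) = V b - (V a :: real)"
  using additive_tagged_division_1[OF assms] by simp

text \<open>
  The increment of \<open>g\<close> over \<open>K \<inter> J\<close>.  Cutting the end points off instead of intersecting gives \<open>0\<close> for
  disjoint intervals without a case distinction, and for fixed \<open>K\<close> the value is the increment over
  \<open>J\<close> of one function, so that it telescopes when \<open>J\<close> runs through a division.
\<close>
definition overlap_increment :: "(real \<Rightarrow> real) \<Rightarrow> real set \<Rightarrow> real set \<Rightarrow> real"
  where "overlap_increment g K J =
    g (max (Inf K) (min (Sup K) (Sup J))) - g (max (Inf K) (min (Sup K) (Inf J)))"

lemma overlap_increment_commute: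
  assumes "Inf K \<le> Sup K" "Inf J \<le> Sup J"
  shows "overlap_increment g K J = overlap_increment g J K"
  using assms unfolding overlap_increment_def by (auto simp: max_def min_def)

lemma sum_overlap_increment:
  assumes "a \<le> b" and q: "q tagged_division_of {a..b}"
    and "a \<le> Inf K" "Inf K \<le> Sup K" "Sup K \<le> b"
  shows "(\<Sum>(y, J)\<in>q. overlap_increment g K J) = g (Sup K) - g (Inf K)"
  using sum_increments[OF assms(1,2), of "\<lambda>s. g (max (Inf K) (min (Sup K) s))"] assms(3-5)
  by (simp add: overlap_increment_def)

text \<open>
  Passing to the common refinement: every increment of \<open>g\<close> is split into its parts over the overlaps
  \<open>K \<inter> J\<close>, after which both sums weight the same increments, by \<open>f x\<close> and by \<open>f y\<close> respectively.
\<close>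
lemma rs_sum_diff_le:
  assumes ab: "a \<le> b" and dom: "increments_dominated a b g V"
    and p: "p tagged_division_of {a..b}" and q: "q tagged_division_of {a..b}"
    and close: "\<And>x K y J. (x, K) \<in> p \<Longrightarrow> (y, J) \<in> q \<Longrightarrow> K \<inter> J \<noteq> {} \<Longrightarrow> \<bar>f x - f y\<bar> \<le> \<epsilon>"
  shows "\<bar>rs_sum f g p - rs_sum f g q\<bar> \<le> \<epsilon> * (V b - V a)"
proof -
  note pD = tagged_division_intervalD[OF p] and qD = tagged_division_intervalD[OF q]
  let ?D = "overlap_increment"
  have sump: "(\<Sum>(y, J)\<in>q. ?D h K J) = h (Sup K) - h (Inf K)" if "(x, K) \<in> p" for h x K
    by (rule sum_overlap_increment[OF ab q]) (use pD(2-5)[OF that] in auto)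
  have sumq: "(\<Sum>(x, K)\<in>p. ?D h J K) = h (Sup J) - h (Inf J)" if "(y, J) \<in> q" for h y J
    by (rule sum_overlap_increment[OF ab p]) (use qD(2-5)[OF that] in auto)
  have comm: "?D g J K = ?D g K J" if "(x, K) \<in> p" "(y, J) \<in> q" for x K y J
    by (rule overlap_increment_commute) (use pD(2,3)[OF that(1)] qD(2,3)[OF that(2)] in auto)
  have "rs_sum f g p = (\<Sum>(x, K)\<in>p. f x * (\<Sum>(y, J)\<in>q. ?D g K J))"
    unfolding rs_sum_def by (rule sum.cong[OF refl]) (clarify, simp only: sump)
  then have Sp: "rs_sum f g p = (\<Sum>(x, K)\<in>p. \<Sum>(y, J)\<in>q. f x * ?D g K J)"
    by (simp add: sum_distrib_left case_prod_unfold)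
  have "rs_sum f g q = (\<Sum>(y, J)\<in>q. f y * (\<Sum>(x, K)\<in>p. ?D g J K))"
    unfolding rs_sum_def by (rule sum.cong[OF refl]) (clarify, simp only: sumq)
  also have "\<dots> = (\<Sum>(y, J)\<in>q. \<Sum>(x, K)\<in>p. f y * ?D g K J)"
    by (rule sum.cong[OF refl], clarify, unfold sum_distrib_left, rule sum.cong[OF refl], clarify)
      (subst comm, assumption, assumption, rule refl)
  also have "\<dots> = (\<Sum>(x, K)\<in>p. \<Sum>(y, J)\<in>q. f y * ?D g K J)"
    unfolding case_prod_unfold by (rule sum.swap)
  finally have "rs_sum f g p - rs_sum f g q
      = (\<Sum>(x, K)\<in>p. \<Sum>(y, J)\<in>q. (f x - f y) * ?D g K J)"
    unfolding Sp by (simp add: sum_subtractf case_prod_unfold left_diff_distrib)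
  also have "\<bar>\<dots>\<bar> \<le> (\<Sum>(x, K)\<in>p. \<Sum>(y, J)\<in>q. \<bar>(f x - f y) * ?D g K J\<bar>)"
    unfolding case_prod_unfold by (rule order_trans[OF sum_abs], rule sum_mono, rule sum_abs)
  also have "\<dots> \<le> (\<Sum>(x, K)\<in>p. \<Sum>(y, J)\<in>q. \<epsilon> * ?D V K J)"
  proof -
    have "\<bar>(f x - f y) * ?D g K J\<bar> \<le> \<epsilon> * ?D V K J" if K: "(x, K) \<in> p" and J: "(y, J) \<in> q" for x K y J
    proof (cases "K \<inter> J = {}")
      case True
      moreover have "max (Inf K) (Inf J) \<in> {Inf K..Sup K} \<inter> {Inf J..Sup J}"
        if "Inf J \<le> Sup K" "Inf K \<le> Sup J"
        using that pD(2,3)[OF K] qD(2,3)[OF J] by auto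
      ultimately have "Sup K < Inf J \<or> Sup J < Inf K"
        using pD(1)[OF K] qD(1)[OF J] by (metis empty_iff not_le)
      then show ?thesis using pD(2,3)[OF K] qD(2,3)[OF J] by (auto simp: overlap_increment_def)
    next
      case False
      have "\<bar>?D g K J\<bar> \<le> ?D V K J"
        unfolding overlap_increment_def
        by (rule increments_dominatedD[OF dom]) (use pD(2-5)[OF K] qD(2-5)[OF J] in auto)
      then show ?thesis unfolding abs_mult
        by (intro mult_mono close[OF K J False]) (use close[OF K J False] in auto)
    qed
    then show ?thesis by (auto intro!: sum_mono)
  qed
  also have "\<dots> = \<epsilon> * (\<Sum>(x, K)\<in>p. \<Sum>(y, J)\<in>q. ?D V K J)"
    by (simp add: sum_distrib_left case_prod_unfold)
  also have "(\<Sum>(x, K)\<in>p. \<Sum>(y, J)\<in>q. ?D V K J) = (\<Sum>(x, K)\<in>p. V (Sup K) - V (Inf K))"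
    by (rule sum.cong[OF refl]) (clarify, simp only: sump)
  also have "\<dots> = V b - V a" by (rule sum_increments[OF ab p])
  finally show ?thesis .
qed

lemma fine_tagged_division_exists:
  assumes "\<delta> > 0"
  obtains p where "p tagged_division_of {a..b::real}" "(\<lambda>x. ball x \<delta>) fine p"
  by (rule fine_division_exists_real[OF gauge_ball[OF assms]]) (rule that)

lemma has_rs_integral_iff_rs_sum:
  "has_rs_integral f g a b I \<longleftrightarrow> (\<forall>\<epsilon>>0. \<exists>\<delta>>0. \<forall>p. p tagged_division_of {a..b} \<and>
     (\<lambda>x. ball x \<delta>) fine p \<longrightarrow> \<bar>rs_sum f g p - I\<bar> < \<epsilon>)"
  unfolding has_rs_integral_def rs_sum_def ..

lemma has_rs_integralE:
  assumes "has_rs_integral f g a b I" "\<epsilon> > 0"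
  obtains \<delta> where "\<delta> > 0" "\<And>p. p tagged_division_of {a..b} \<Longrightarrow> (\<lambda>x. ball x \<delta>) fine p \<Longrightarrow>
    \<bar>rs_sum f g p - I\<bar> < \<epsilon>"
  using assms unfolding has_rs_integral_iff_rs_sum by metis

lemma fine_ball_mono:
  assumes "\<delta> \<le> \<delta>'" "(\<lambda>x. ball x \<delta>) fine p"
  shows "(\<lambda>x. ball x \<delta>') fine p"
proof (rule fineI)
  fix x K assume "(x, K) \<in> p"
  then show "K \<subseteq> ball x \<delta>'" using fineD[OF assms(2)] subset_ball[OF assms(1)] by (meson order_trans)
qed

text \<open>
  Uniform continuity of \<open>f\<close> controls \<open>f x - f y\<close> on all overlaps at once.
\<close>
lemma rs_sums_cauchy:
  assumes ab: "a \<le> b" and f: "continuous_on {a..b} f" and dom: "increments_dominated a b g V"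
    and "\<epsilon> > 0"
  obtains \<delta> where "\<delta> > 0"
    "\<And>p q. p tagged_division_of {a..b} \<Longrightarrow> (\<lambda>x. ball x \<delta>) fine p \<Longrightarrow>
       q tagged_division_of {a..b} \<Longrightarrow> (\<lambda>x. ball x \<delta>) fine q \<Longrightarrow>
       \<bar>rs_sum f g p - rs_sum f g q\<bar> < \<epsilon>"
proof -
  have VV: "V b - V a \<ge> 0" using increments_dominated_mono[OF dom, of a b] ab by simp
  define e where "e = \<epsilon> / (V b - V a + 1)"
  have e: "e > 0" "e * (V b - V a) < \<epsilon>"
    using VV \<open>\<epsilon> > 0\<close> by (simp_all add: e_def divide_simps)
  have "uniformly_continuous_on {a..b} f" using f by (simp add: compact_uniformly_continuous)
  then obtain d where d: "d > 0" "\<And>x y. x \<in> {a..b} \<Longrightarrow> y \<in> {a..b} \<Longrightarrow> dist y x < d \<Longrightarrow> dist (f y) (f x) < e"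
    unfolding uniformly_continuous_on_def using e(1) by metis
  \<comment> \<open>Tags of overlapping intervals are at distance less than twice the radius of the gauge.\<close>
  show ?thesis
  proof
    show "d / 2 > 0" using d by simp
    fix p q assume p: "p tagged_division_of {a..b}" "(\<lambda>x. ball x (d/2)) fine p"
      and q: "q tagged_division_of {a..b}" "(\<lambda>x. ball x (d/2)) fine q"
    have "\<bar>rs_sum f g p - rs_sum f g q\<bar> \<le> e * (V b - V a)"
    proof (rule rs_sum_diff_le[OF ab dom p(1) q(1)])
      fix x K y J assume K: "(x, K) \<in> p" and J: "(y, J) \<in> q" and "K \<inter> J \<noteq> {}"
      then obtain z where "z \<in> K" "z \<in> J" by auto
      then have "z \<in> ball x (d/2)" "z \<in> ball y (d/2)"
        using subsetD[OF fineD[OF p(2) K]] subsetD[OF fineD[OF q(2) J]] by simp_all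
      then have "dist x y < d" unfolding mem_ball dist_real_def by linarith
      moreover have "x \<in> {a..b}" "y \<in> {a..b}"
        using tagged_division_intervalD(2-5)[OF p(1) K] tagged_division_intervalD(2-5)[OF q(1) J] by auto
      ultimately have "dist (f x) (f y) < e" by (intro d(2)) auto
      then show "\<bar>f x - f y\<bar> \<le> e" by (simp add: dist_real_def)
    qed
    then show "\<bar>rs_sum f g p - rs_sum f g q\<bar> < \<epsilon>" using e(2) by linarith
  qed
qed

lemma has_rs_integral_rs_integral:
  assumes ab: "a \<le> b" and f: "continuous_on {a..b} f" and dom: "increments_dominated a b g V"
  shows "has_rs_integral f g a b (rs_integral f g a b)"
proof -
  have "\<exists>p. p tagged_division_of {a..b} \<and> (\<lambda>x. ball x (1 / real (Suc n))) fine p" for n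
    by (rule fine_tagged_division_exists[of "1 / real (Suc n)" a b]) auto
  then obtain P where P: "\<And>n. P n tagged_division_of {a..b}"
    "\<And>n. (\<lambda>x. ball x (1 / real (Suc n))) fine P n" by metis
  have fineP: "(\<lambda>x. ball x \<delta>) fine P n" if "N > 0" "1 / real N < \<delta>" "n \<ge> N" for \<delta> n N
  proof (rule fine_ball_mono[OF _ P(2)])
    have "1 / real (Suc n) \<le> 1 / real N" using that by (intro divide_left_mono) auto
    then show "1 / real (Suc n) \<le> \<delta>" using that(2) by linarith
  qed
  have "Cauchy (\<lambda>n. rs_sum f g (P n))"
  proof (rule metric_CauchyI)
    fix e :: real assume "e > 0"
    obtain d where d: "d > 0" "\<And>p q. p tagged_division_of {a..b} \<Longrightarrow> (\<lambda>x. ball x d) fine p \<Longrightarrow>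
       q tagged_division_of {a..b} \<Longrightarrow> (\<lambda>x. ball x d) fine q \<Longrightarrow>
       \<bar>rs_sum f g p - rs_sum f g q\<bar> < e" using rs_sums_cauchy[OF ab f dom \<open>e > 0\<close>] by metis
    obtain k where "inverse (real (Suc k)) < d" using reals_Archimedean[OF d(1)] ..
    then obtain N where N: "N > 0" "1 / real N < d"
      using that[of "Suc k"] by (simp add: inverse_eq_divide)
    show "\<exists>M. \<forall>m\<ge>M. \<forall>n\<ge>M. dist (rs_sum f g (P m)) (rs_sum f g (P n)) < e"
      unfolding dist_real_def
      by (intro exI[of _ N] allI impI d(2)[OF P(1) fineP[OF N] P(1) fineP[OF N]])
  qed
  then obtain I where I: "(\<lambda>n. rs_sum f g (P n)) \<longlonglongrightarrow> I"
    using Cauchy_convergent convergent_def by blast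
  have "has_rs_integral f g a b I"
    unfolding has_rs_integral_iff_rs_sum
  proof (intro allI impI)
    fix e :: real assume "e > 0"
    obtain d where d: "d > 0" "\<And>p q. p tagged_division_of {a..b} \<Longrightarrow> (\<lambda>x. ball x d) fine p \<Longrightarrow>
       q tagged_division_of {a..b} \<Longrightarrow> (\<lambda>x. ball x d) fine q \<Longrightarrow>
       \<bar>rs_sum f g p - rs_sum f g q\<bar> < e/2" using rs_sums_cauchy[OF ab f dom half_gt_zero[OF \<open>e > 0\<close>]] by metis
    obtain k where "inverse (real (Suc k)) < d" using reals_Archimedean[OF d(1)] ..
    then obtain N where N: "N > 0" "1 / real N < d"
      using that[of "Suc k"] by (simp add: inverse_eq_divide)
    have "\<bar>rs_sum f g p - I\<bar> < e" if "p tagged_division_of {a..b}" "(\<lambda>x. ball x d) fine p" for p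
    proof -
      have "(\<lambda>n. \<bar>rs_sum f g p - rs_sum f g (P n)\<bar>) \<longlonglongrightarrow> \<bar>rs_sum f g p - I\<bar>"
        by (intro tendsto_intros I)
      moreover have "\<forall>n\<ge>N. \<bar>rs_sum f g p - rs_sum f g (P n)\<bar> \<le> e/2"
        using d(2)[OF that P(1) fineP[OF N]] by (simp add: less_imp_le)
      ultimately have "\<bar>rs_sum f g p - I\<bar> \<le> e/2" by (intro LIMSEQ_le_const2 exI)
      then show ?thesis using \<open>e > 0\<close> by simp
    qed
    then show "\<exists>\<delta>>0. \<forall>p. p tagged_division_of {a..b} \<and> (\<lambda>x. ball x \<delta>) fine p \<longrightarrow> \<bar>rs_sum f g p - I\<bar> < e"
      using d(1) by (intro exI[of _ d]) simp
  qed
  then show ?thesis by (simp add: rs_integral_eqI)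
qed

lemma abs_rs_sum_le:
  assumes ab: "a \<le> b" and dom: "increments_dominated a b g V"
    and p: "p tagged_division_of {a..b}"
    and step: "\<And>x K. (x, K) \<in> p \<Longrightarrow> \<bar>f x\<bar> * (V (Sup K) - V (Inf K)) \<le> W (Sup K) - W (Inf K)"
  shows "\<bar>rs_sum f g p\<bar> \<le> W b - W a"
proof -
  have "\<bar>rs_sum f g p\<bar> \<le> (\<Sum>(x, K)\<in>p. \<bar>f x * (g (Sup K) - g (Inf K))\<bar>)"
    unfolding rs_sum_def case_prod_unfold by (rule sum_abs)
  also have "\<dots> \<le> (\<Sum>(x, K)\<in>p. W (Sup K) - W (Inf K))"
  proof (intro sum_mono, clarify)
    fix x K assume K: "(x, K) \<in> p"
    note KD = tagged_division_intervalD[OF p K]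
    have "\<bar>f x * (g (Sup K) - g (Inf K))\<bar> \<le> \<bar>f x\<bar> * (V (Sup K) - V (Inf K))"
      unfolding abs_mult by (intro mult_left_mono increments_dominatedD[OF dom]) (use KD(2-5) in auto)
    with step[OF K] show "\<bar>f x * (g (Sup K) - g (Inf K))\<bar> \<le> W (Sup K) - W (Inf K)" by linarith
  qed
  also have "\<dots> = W b - W a" by (rule sum_increments[OF ab p])
  finally show ?thesis .
qed

text \<open>
  Estimates of the integral by increments of a monotone primitive need the integrand at the left
  end points.
\<close>
lemma left_tagged_division:
  assumes p: "p tagged_division_of {a..b::real}" and fine: "(\<lambda>x. ball x \<delta>) fine p"
  shows "(\<lambda>(x, K). (Inf K, K)) ` p tagged_division_of {a..b}"
    and "(\<lambda>x. ball x (2 * \<delta>)) fine (\<lambda>(x, K). (Inf K, K)) ` p"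
proof -
  note pD = tagged_division_intervalD[OF p] and D = tagged_division_ofD[OF p]
  let ?q = "(\<lambda>(x, K). (Inf K, K)) ` p"
  have InfK: "Inf K \<in> K" if "(x, K) \<in> p" for x K
    using pD(2,3)[OF that] by (subst pD(1)[OF that]) auto
  show "?q tagged_division_of {a..b}"
  proof (rule tagged_division_ofI)
    show "finite ?q" using D(1) by simp
    fix x K assume "(x, K) \<in> ?q"
    then obtain y where y: "(y, K) \<in> p" "x = Inf K" by auto
    show "x \<in> K" using InfK[OF y(1)] y(2) by simp
    show "K \<subseteq> {a..b}" by (rule D(3)[OF y(1)])
    show "\<exists>a b. K = cbox a b" by (rule D(4)[OF y(1)])
    fix x' K' assume "(x', K') \<in> ?q" "(x, K) \<noteq> (x', K')"
    then obtain y' where y': "(y', K') \<in> p" "x' = Inf K'" by auto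
    then have "(y, K) \<noteq> (y', K')" using y(2) \<open>(x, K) \<noteq> (x', K')\<close> by auto
    then show "interior K \<inter> interior K' = {}" by (rule D(5)[OF y(1) y'(1)])
  next
    have "{K. \<exists>x. (x, K) \<in> ?q} = {K. \<exists>x. (x, K) \<in> p}" by force
    then show "\<Union>{K. \<exists>x. (x, K) \<in> ?q} = {a..b}" using D(6) by simp
  qed
  show "(\<lambda>x. ball x (2 * \<delta>)) fine ?q"
  proof (rule fineI, clarify)
    fix x K z assume K: "(x, K) \<in> p" and z: "z \<in> K"
    have "z \<in> ball x \<delta>" "Inf K \<in> ball x \<delta>" 
      using subsetD[OF fineD[OF fine K] z] subsetD[OF fineD[OF fine K] InfK[OF K]] by simp_all
    then show "z \<in> ball (Inf K) (2 * \<delta>)" unfolding mem_ball dist_real_def by linarith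
  qed
qed

text \<open>
  The step condition says that \<open>W\<close> grows at least as fast as \<open>\<integral> \<bar>f\<bar> dV\<close>, as seen by left Riemann sums.
  Evaluating \<open>f\<close> only at left end points is what allows \<open>W = V\<^bsup>k+1\<^esup> / (k + 1)\<close> when \<open>\<bar>f\<bar> \<le> V\<^sup>k\<close>:
  sums with arbitrary tags would overshoot it.
\<close>
lemma abs_has_rs_integral_le:
  assumes ab: "a \<le> b" and dom: "increments_dominated a b g V"
    and I: "has_rs_integral f g a b I"
    and step: "\<And>s t. a \<le> s \<Longrightarrow> s \<le> t \<Longrightarrow> t \<le> b \<Longrightarrow> \<bar>f s\<bar> * (V t - V s) \<le> W t - W s"
  shows "\<bar>I\<bar> \<le> W b - W a"
proof (rule field_le_epsilon)
  fix e :: real assume "e > 0"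
  obtain d where d: "d > 0" "\<And>p. p tagged_division_of {a..b} \<Longrightarrow> (\<lambda>x. ball x d) fine p \<Longrightarrow>
      \<bar>rs_sum f g p - I\<bar> < e"
    using has_rs_integralE[OF I \<open>e > 0\<close>] by metis
  obtain p where p: "p tagged_division_of {a..b}" "(\<lambda>x. ball x (d/2)) fine p"
    using fine_tagged_division_exists[of "d/2"] d(1) by auto
  let ?q = "(\<lambda>(x, K). (Inf K, K)) ` p"
  note q = left_tagged_division[OF p]
  have "\<bar>rs_sum f g ?q - I\<bar> < e" using d(2) q by simp
  moreover have "\<bar>rs_sum f g ?q\<bar> \<le> W b - W a"
  proof (rule abs_rs_sum_le[OF ab dom q(1)])
    fix x K assume K: "(x, K) \<in> ?q"
    then have "x = Inf K" by auto
    then show "\<bar>f x\<bar> * (V (Sup K) - V (Inf K)) \<le> W (Sup K) - W (Inf K)"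
      using tagged_division_intervalD(2-5)[OF q(1) K] step by simp
  qed
  ultimately show "\<bar>I\<bar> \<le> W b - W a + e" by linarith
qed

lemma has_rs_integral_combine:
  assumes "a \<le> c" "c \<le> b"
    and I: "has_rs_integral f g a c I" and J: "has_rs_integral f g c b J"
    and T: "has_rs_integral f g a b T"
  shows "T = I + J"
proof -
  have "\<bar>T - (I + J)\<bar> \<le> e" if "e > 0" for e
  proof -
    have e3: "e / 3 > 0" using that by simp
    obtain d1 where d1: "d1 > 0" "\<And>p. p tagged_division_of {a..c} \<Longrightarrow> (\<lambda>x. ball x d1) fine p \<Longrightarrow>
      \<bar>rs_sum f g p - I\<bar> < e/3" using has_rs_integralE[OF I e3] by metis
    obtain d2 where d2: "d2 > 0" "\<And>p. p tagged_division_of {c..b} \<Longrightarrow> (\<lambda>x. ball x d2) fine p \<Longrightarrow>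
      \<bar>rs_sum f g p - J\<bar> < e/3" using has_rs_integralE[OF J e3] by metis
    obtain d3 where d3: "d3 > 0" "\<And>p. p tagged_division_of {a..b} \<Longrightarrow> (\<lambda>x. ball x d3) fine p \<Longrightarrow>
      \<bar>rs_sum f g p - T\<bar> < e/3" using has_rs_integralE[OF T e3] by metis
    define d where "d = min d1 (min d2 d3)"
    have d: "d > 0" "d \<le> d1" "d \<le> d2" "d \<le> d3" using d1 d2 d3 by (auto simp: d_def)
    obtain p where p: "p tagged_division_of {a..c}" "(\<lambda>x. ball x d) fine p"
      using fine_tagged_division_exists[OF d(1)] .
    obtain q where q: "q tagged_division_of {c..b}" "(\<lambda>x. ball x d) fine q"
      using fine_tagged_division_exists[OF d(1)] .
    have un: "{a..c} \<union> {c..b} = {a..b}" using assms(1,2) by auto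
    have "p \<union> q tagged_division_of {a..b}"
      using tagged_division_Un[OF p(1) q(1)] un by auto
    moreover have "(\<lambda>x. ball x d) fine p \<union> q" using p q by (intro fine_Un)
    ultimately have T': "\<bar>rs_sum f g (p \<union> q) - T\<bar> < e/3"
      by (intro d3(2) fine_ball_mono[OF d(4)])
    have "rs_sum f g (p \<union> q) = rs_sum f g p + rs_sum f g q"
      unfolding rs_sum_def
    proof (rule sum.union_inter_neutral)
      show "finite p" "finite q" using p q by auto
      show "\<forall>x\<in>p \<inter> q. (case x of (x, K) \<Rightarrow> f x * (g (Sup K) - g (Inf K))) = 0"
      proof clarify
        fix x K assume K: "(x, K) \<in> p" "(x, K) \<in> q"
        have "Inf K = c" "Sup K = c"
          using tagged_division_intervalD(2-5)[OF p(1) K(1)] tagged_division_intervalD(2-5)[OF q(1) K(2)] by auto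
        then show "f x * (g (Sup K) - g (Inf K)) = 0" by simp
      qed
    qed
    moreover have "\<bar>rs_sum f g p - I\<bar> < e/3" "\<bar>rs_sum f g q - J\<bar> < e/3"
      using d1(2)[OF p(1) fine_ball_mono[OF d(2) p(2)]] d2(2)[OF q(1) fine_ball_mono[OF d(3) q(2)]]
      by simp_all
    ultimately show ?thesis using T' by linarith
  qed
  then show ?thesis by (metis abs_le_zero_iff dense_ge eq_iff_diff_eq_0)
qed

lemma has_rs_integral_diff:
  assumes "has_rs_integral f g a b I" "a \<le> b"
  shows "has_rs_integral (\<lambda>x. f x - c) g a b (I - c * (g b - g a))"
proof -
  have "rs_sum (\<lambda>x. f x - c) g p = rs_sum f g p - c * (g b - g a)" if "p tagged_division_of {a..b}" for p
    using sum_increments[OF assms(2) that, of g]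
    by (simp add: rs_sum_def sum_subtractf left_diff_distrib case_prod_unfold sum_distrib_left[symmetric])
  then show ?thesis using assms(1) unfolding has_rs_integral_iff_rs_sum by auto
qed

text \<open>
  Between \<open>s\<close> and \<open>t\<close> the integral changes by \<open>f s * (g t - g s)\<close> plus the integral of \<open>f - f s\<close>.  The
  first term is small because \<open>g\<close> is continuous, and the second because \<open>f\<close> is continuous while the
  variation is bounded.
\<close>
lemma continuous_on_rs_integral:
  assumes f: "continuous_on {a..b} f" and g: "continuous_on {a..b} g"
    and dom: "increments_dominated a b g V"
  shows "continuous_on {a..b} (rs_integral f g a)"
proof (cases "a \<le> b")
  case True
  have step: "\<bar>rs_integral f g a t - rs_integral f g a s\<bar>
      \<le> \<bar>f s\<bar> * \<bar>g t - g s\<bar> + \<epsilon> * (V b - V a)"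
    if st: "a \<le> s" "s \<le> t" "t \<le> b" and close: "\<And>x. s \<le> x \<Longrightarrow> x \<le> t \<Longrightarrow> \<bar>f x - f s\<bar> \<le> \<epsilon>" for s t \<epsilon>
  proof -
    have dom': "increments_dominated s t g V" "increments_dominated a s g V" "increments_dominated a t g V"
      using st by (auto intro: increments_dominated_subinterval[OF dom])
    have cont: "continuous_on {s..t} f" "continuous_on {a..s} f" "continuous_on {a..t} f"
      using st by (auto intro: continuous_on_subset[OF f])
    have J: "has_rs_integral f g s t (rs_integral f g s t)"
      using has_rs_integral_rs_integral[OF st(2) cont(1) dom'(1)] .
    have "rs_integral f g a t = rs_integral f g a s + rs_integral f g s t"
      by (rule has_rs_integral_combine[OF st(1,2) _ J])
        (use has_rs_integral_rs_integral[OF _ cont(2) dom'(2)]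
          has_rs_integral_rs_integral[OF _ cont(3) dom'(3)] st in auto)
    moreover have "\<bar>rs_integral f g s t - f s * (g t - g s)\<bar> \<le> \<epsilon> * V t - \<epsilon> * V s"
    proof (rule abs_has_rs_integral_le[OF st(2) dom'(1) has_rs_integral_diff[OF J st(2)]])
      fix x y assume "s \<le> x" "x \<le> y" "y \<le> t"
      then show "\<bar>f x - f s\<bar> * (V y - V x) \<le> \<epsilon> * V y - \<epsilon> * V x"
        using mult_right_mono[OF close[of x], of "V y - V x"] increments_dominated_mono[OF dom'(1), of x y]
        by (simp add: right_diff_distrib)
    qed
    moreover have "\<epsilon> * V t - \<epsilon> * V s \<le> \<epsilon> * (V b - V a)"
      using close[of s] st increments_dominated_mono[OF dom, of a s]
        increments_dominated_mono[OF dom, of t b]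
      by (auto simp: right_diff_distrib[symmetric] intro!: mult_left_mono)
    ultimately show ?thesis unfolding abs_mult[symmetric] by linarith
  qed
  obtain M where "\<forall>y\<in>f ` {a..b}. norm y \<le> M" and M_pos: "M > 0"
    using compact_imp_bounded[OF compact_continuous_image[OF f compact_Icc]]
    unfolding bounded_pos by metis
  then have M: "\<And>x. x \<in> {a..b} \<Longrightarrow> \<bar>f x\<bar> \<le> M" "M > 0" by simp_all
  define C where "C = V b - V a + M + 1"
  have VV: "V b - V a \<ge> 0" using increments_dominated_mono[OF dom, of a b] True by simp
  have "C > 0" using M VV by (simp add: C_def)
  show ?thesis
    unfolding continuous_on_iff
  proof (intro ballI allI impI)
    fix s e assume s: "s \<in> {a..b}" and e: "(e::real) > 0"
    define \<epsilon> where "\<epsilon> = e / (2 * C)"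
    have "\<epsilon> > 0" using e \<open>C > 0\<close> by (simp add: \<epsilon>_def)
    have "uniformly_continuous_on {a..b} f" "uniformly_continuous_on {a..b} g"
      using f g by (simp_all add: compact_uniformly_continuous)
    then obtain d1 d2 where d1: "d1 > 0" "\<And>x y. x \<in> {a..b} \<Longrightarrow> y \<in> {a..b} \<Longrightarrow> dist y x < d1 \<Longrightarrow> dist (f y) (f x) < \<epsilon>"
      and d2: "d2 > 0" "\<And>x y. x \<in> {a..b} \<Longrightarrow> y \<in> {a..b} \<Longrightarrow> dist y x < d2 \<Longrightarrow> dist (g y) (g x) < \<epsilon>"
      unfolding uniformly_continuous_on_def using \<open>\<epsilon> > 0\<close> by metis
    have main: "\<bar>rs_integral f g a v - rs_integral f g a u\<bar> < e"
      if uv: "a \<le> u" "u \<le> v" "v \<le> b" "v - u < min d1 d2" for u v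
    proof -
      have "\<bar>f x - f u\<bar> \<le> \<epsilon>" if "u \<le> x" "x \<le> v" for x
        using d1(2)[of u x] uv that by (simp add: dist_real_def)
      from step[OF uv(1-3) this]
      have "\<bar>rs_integral f g a v - rs_integral f g a u\<bar> \<le> \<bar>f u\<bar> * \<bar>g v - g u\<bar> + \<epsilon> * (V b - V a)" .
      also have "\<dots> \<le> M * \<epsilon> + \<epsilon> * (V b - V a)"
        using d2(2)[of u v] uv M(1)[of u] M(2)
        by (intro add_right_mono mult_mono) (auto simp: dist_real_def)
      also have "\<dots> \<le> \<epsilon> * C" using \<open>\<epsilon> > 0\<close> by (simp add: C_def algebra_simps)
      also have "\<dots> < e" using e \<open>C > 0\<close> by (simp add: \<epsilon>_def)
      finally show ?thesis .
    qed
    show "\<exists>d>0. \<forall>x'\<in>{a..b}. dist x' s < d \<longrightarrow> dist (rs_integral f g a x') (rs_integral f g a s) < e"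
    proof (intro exI conjI ballI impI)
      show "min d1 d2 > 0" using d1 d2 by simp
      fix t assume t: "t \<in> {a..b}" "dist t s < min d1 d2"
      then show "dist (rs_integral f g a t) (rs_integral f g a s) < e"
        using main[of s t] main[of t s] s by (cases "s \<le> t") (auto simp: dist_real_def abs_minus_commute)
    qed
  qed
qed simp

text \<open>
  A left Riemann sum of \<open>(k + 1) x\<^sup>k\<close> stays below the increment of its primitive.
\<close>
lemma power_step_le:
  fixes x y :: real
  assumes "0 \<le> x" "x \<le> y"
  shows "real (Suc k) * (x ^ k * (y - x)) \<le> y ^ Suc k - x ^ Suc k"
proof -
  have "(y - x) * (\<Sum>i<Suc k. x ^ k) \<le> (y - x) * (\<Sum>i<Suc k. y ^ (k - i) * x ^ i)"
  proof (intro mult_left_mono sum_mono)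
    fix i assume "i \<in> {..<Suc k}"
    then have "x ^ k = x ^ (k - i) * x ^ i" by (simp flip: power_add)
    also have "\<dots> \<le> y ^ (k - i) * x ^ i" using assms by (intro mult_right_mono power_mono) auto
    finally show "x ^ k \<le> y ^ (k - i) * x ^ i" .
  qed (use assms in auto)
  also have "\<dots> = (y - x) * (\<Sum>i<Suc k. y ^ i * x ^ (k - i))"
    by (subst sum.nat_diff_reindex[symmetric]) (auto intro!: sum.cong)
  also have "\<dots> = y ^ Suc k - x ^ Suc k"
    by (simp only: diff_power_eq_sum)
  finally show ?thesis by (simp add: algebra_simps)
qed

text \<open>
  Integrating the bound \<open>(V s - V a)\<^sup>k / k!\<close> against \<open>dV\<close> gives the next one.  Continuity is
  carried along because it guarantees that the next integral exists.
\<close>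
lemma iterated_integral_bound:
  fixes \<gamma> :: "real \<Rightarrow> real ^ 'd::finite"
  assumes dom: "\<And>i. increments_dominated a b (\<lambda>s. \<gamma> s $ i) V"
    and cont: "\<And>i. continuous_on {a..b} (\<lambda>s. \<gamma> s $ i)"
  shows "continuous_on {a..b} (iterated_integral \<gamma> a w)"
    and "t \<in> {a..b} \<Longrightarrow> \<bar>iterated_integral \<gamma> a w t\<bar> \<le> (V t - V a) ^ length w / fact (length w)"
proof (induction w arbitrary: t)
  case (Cons i w)
  have eq: "iterated_integral \<gamma> a (i # w) = rs_integral (iterated_integral \<gamma> a w) (\<lambda>s. \<gamma> s $ i) a"
    by auto
  {
    case 1
    show ?case unfolding eq by (rule continuous_on_rs_integral[OF Cons(1) cont dom])
  next
    case 2
    then have t: "a \<le> t" "t \<le> b" by auto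
    have dom': "increments_dominated a t (\<lambda>s. \<gamma> s $ i) V"
      using increments_dominated_subinterval[OF dom] t by blast
    have cont': "continuous_on {a..t} (iterated_integral \<gamma> a w)"
      using continuous_on_subset[OF Cons(1)] t by auto
    let ?k = "length w"
    let ?W = "\<lambda>s. (V s - V a) ^ Suc ?k / fact (Suc ?k)"
    have "\<bar>rs_integral (iterated_integral \<gamma> a w) (\<lambda>s. \<gamma> s $ i) a t\<bar> \<le> ?W t - ?W a"
    proof (rule abs_has_rs_integral_le[OF t(1) dom' has_rs_integral_rs_integral[OF t(1) cont' dom']])
      fix s s' assume s: "a \<le> s" "s \<le> s'" "s' \<le> t"
      have V: "V a \<le> V s" "V s \<le> V s'" using s by (auto intro: increments_dominated_mono[OF dom'])
      have "\<bar>iterated_integral \<gamma> a w s\<bar> * (V s' - V s) \<le> (V s - V a) ^ ?k / fact ?k * (V s' - V s)"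
        using Cons(2)[of s] s t V by (intro mult_right_mono) auto
      also have "\<dots> = real (Suc ?k) * ((V s - V a) ^ ?k * ((V s' - V a) - (V s - V a))) / fact (Suc ?k)"
        by (simp add: fact_Suc del: of_nat_Suc)
      also have "\<dots> \<le> ((V s' - V a) ^ Suc ?k - (V s - V a) ^ Suc ?k) / fact (Suc ?k)"
        using V by (intro divide_right_mono power_step_le) auto
      finally show "\<bar>iterated_integral \<gamma> a w s\<bar> * (V s' - V s) \<le> ?W s' - ?W s"
        by (simp add: diff_divide_distrib)
    qed
    then show ?case by simp
  }
qed auto

text \<open>
  \<open>V t\<close> is the variation of \<open>f\<close> over \<open>{a..t}\<close>: appending the interval \<open>{s..t}\<close> to a division of \<open>{a..s}\<close>
  shows that it increases by at least \<open>norm (f t - f s)\<close>.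
\<close>
lemma rectifiable_dominated:
  fixes f :: "real \<Rightarrow> 'a::real_normed_vector"
  assumes ab: "a \<le> b" and bv: "bounded_variation_on a b f"
  obtains V where "\<And>s t. a \<le> s \<Longrightarrow> s \<le> t \<Longrightarrow> t \<le> b \<Longrightarrow> norm (f t - f s) \<le> V t - V s"
proof -
  let ?v = "\<lambda>D. \<Sum>K\<in>D. norm (f (Sup K) - f (Inf K))"
  define V where "V t = Sup (?v ` {D. D division_of {a..t}})" for t
  obtain B where B: "\<And>D. D division_of {a..b} \<Longrightarrow> ?v D \<le> B"
    using bv unfolding bounded_variation_on_def by auto
  have extend: "\<exists>E. E division_of {a..t} \<and> ?v D + norm (f t - f s) = ?v E"
    if D: "D division_of {a..s}" and st: "a \<le> s" "s \<le> t" for D s t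
  proof (cases "s = t")
    case True
    then show ?thesis using D by auto
  next
    case False
    then have "s < t" using st by simp
    have notin: "{s..t} \<notin> D"
      using division_ofD(2)[OF D] \<open>s < t\<close> by fastforce
    have "insert {s..t} D division_of {s..t} \<union> {a..s}"
      using division_disjoint_union[OF division_of_self[of s t] D] \<open>s < t\<close> by auto
    moreover have "{s..t} \<union> {a..s} = {a..t}" using st by auto
    ultimately have "insert {s..t} D division_of {a..t}" by simp
    moreover have "?v D + norm (f t - f s) = ?v (insert {s..t} D)"
      using notin division_ofD(1)[OF D] \<open>s < t\<close> by (simp add: add.commute)
    ultimately show ?thesis by blast
  qed
  have bdd: "bdd_above (?v ` {D. D division_of {a..t}})" if at: "a \<le> t" "t \<le> b" for t
  proof (rule bdd_aboveI2)
    fix D assume "D \<in> {D. D division_of {a..t}}"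
    then obtain E where "E division_of {a..b}" "?v D + norm (f b - f t) = ?v E"
      using extend[of D t b] at by auto
    then show "?v D \<le> B" using B[of E] norm_ge_zero[of "f b - f t"] by linarith
  qed
  show thesis
  proof
    fix s t assume st: "a \<le> s" "s \<le> t" "t \<le> b"
    have "V s \<le> V t - norm (f t - f s)"
      unfolding V_def[of s]
    proof (rule cSUP_least)
      show "{D. D division_of {a..s}} \<noteq> {}"
        using division_of_self[of a s] st by (auto simp: box_real)
      fix D assume "D \<in> {D. D division_of {a..s}}"
      then obtain E where E: "E division_of {a..t}" "?v D + norm (f t - f s) = ?v E"
        using extend[of D s t] st by auto
      have "?v E \<le> V t" unfolding V_def using E(1) bdd[of t] st by (auto intro!: cSUP_upper)
      then show "?v D \<le> V t - norm (f t - f s)" using E(2) by linarith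
    qed
    then show "norm (f t - f s) \<le> V t - V s" by linarith
  qed
qed

theorem signature_bound:
  fixes \<gamma> :: "real \<Rightarrow> real ^ 'd::finite"
  assumes "a \<le> b" and "rectifiable_on a b \<gamma>"
  obtains L where "L \<ge> 0" "\<And>w. \<bar>tcoeff (signature a b \<gamma>) w\<bar> \<le> L ^ length w / fact (length w)"
proof -
  obtain V where V: "\<And>s t. a \<le> s \<Longrightarrow> s \<le> t \<Longrightarrow> t \<le> b \<Longrightarrow> norm (\<gamma> t - \<gamma> s) \<le> V t - V s"
    using rectifiable_dominated[OF assms(1)] assms(2) unfolding rectifiable_on_def by metis
  have dom: "increments_dominated a b (\<lambda>s. \<gamma> s $ i) V" for i
    unfolding increments_dominated_def
    using V component_le_norm_cart[of "\<gamma> _ - \<gamma> _" i] by (fastforce intro: order_trans)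
  have cont: "continuous_on {a..b} (\<lambda>s. \<gamma> s $ i)" for i
    using assms(2) unfolding rectifiable_on_def by (auto intro: continuous_on_component)
  show thesis
  proof
    show "V b - V a \<ge> 0" using V[of a b] assms(1) norm_ge_zero order_trans by blast
    show "\<bar>tcoeff (signature a b \<gamma>) w\<bar> \<le> (V b - V a) ^ length w / fact (length w)" for w
      using iterated_integral_bound(2)[OF dom cont, of b "rev w"] assms(1)
      by (simp add: signature_def)
  qed
qed


section \<open>The exponential of the logarithm of a tensor series\<close>

lemma tcoeff_times: "tcoeff (x * y) w = (\<Sum>k\<le>length w. tcoeff x (take k w) * tcoeff y (drop k w))"
  by (simp add: times_tensor_series_def)

lemma tcoeff_one: "tcoeff 1 w = (if w = [] then 1 else 0)"
  by (simp add: one_tensor_series_def)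

text \<open>
  The substitution \<open>F(S)\<close>.  For \<open>S\<close> with zero constant term, \<open>S\<^sup>n\<close> vanishes at words shorter than \<open>n\<close>, so
  the truncation of the series at the length of the word loses nothing.
\<close>
definition tensor_subst :: "real fps \<Rightarrow> 'd tensor_series \<Rightarrow> 'd tensor_series"
  where "tensor_subst F S = Tensor_series (\<lambda>w. \<Sum>n\<le>length w. fps_nth F n * tcoeff (S ^ n) w)"

lemma tcoeff_tensor_subst:
  assumes "tcoeff S [] = 0" "length w \<le> N"
  shows "tcoeff (tensor_subst F S) w = (\<Sum>n\<le>N. fps_nth F n * tcoeff (S ^ n) w)"
  unfolding tensor_subst_def tcoeff_Tensor_series
  by (rule sum.mono_neutral_left) (use assms tcoeff_power_eq_0[OF assms(1)] in auto)

text \<open>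
  Powers of the single element \<open>S\<close> commute, so substitution is an algebra homomorphism even though
  the tensor algebra is not commutative.  This is what transports the identity \<open>exp (ln (1 + X)) = 1 + X\<close>
  from power series in one variable to tensor series.
\<close>
lemma tensor_subst_mult:
  assumes S: "tcoeff S [] = 0"
  shows "tensor_subst (F * G) S = tensor_subst F S * tensor_subst G S"
proof (rule tensor_series_eqI)
  fix w :: "'a list"
  let ?N = "length w"
  define h where "h i k = fps_nth F i * fps_nth G k * tcoeff (S ^ (i + k)) w" for i k
  have "tcoeff (tensor_subst F S * tensor_subst G S) w
      = (\<Sum>l\<le>?N. (\<Sum>i\<le>?N. fps_nth F i * tcoeff (S ^ i) (take l w))
          * (\<Sum>k\<le>?N. fps_nth G k * tcoeff (S ^ k) (drop l w)))"
    unfolding tcoeff_times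
    by (intro sum.cong refl arg_cong2[where f = "(*)"] tcoeff_tensor_subst[OF S]) auto
  also have "\<dots> = (\<Sum>l\<le>?N. \<Sum>i\<le>?N. \<Sum>k\<le>?N. fps_nth F i * fps_nth G k *
      (tcoeff (S ^ i) (take l w) * tcoeff (S ^ k) (drop l w)))"
    by (simp add: sum_product algebra_simps)
  also have "\<dots> = (\<Sum>i\<le>?N. \<Sum>l\<le>?N. \<Sum>k\<le>?N. fps_nth F i * fps_nth G k *
      (tcoeff (S ^ i) (take l w) * tcoeff (S ^ k) (drop l w)))"
    by (rule sum.swap)
  also have "\<dots> = (\<Sum>i\<le>?N. \<Sum>k\<le>?N. \<Sum>l\<le>?N. fps_nth F i * fps_nth G k *
      (tcoeff (S ^ i) (take l w) * tcoeff (S ^ k) (drop l w)))"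
    by (rule sum.cong[OF refl], rule sum.swap)
  also have "\<dots> = (\<Sum>i\<le>?N. \<Sum>k\<le>?N. h i k)"
    by (simp add: h_def power_add tcoeff_times sum_distrib_left)
  also have "\<dots> = (\<Sum>(i, k)\<in>{..?N} \<times> {..?N}. h i k)"
    by (simp add: sum.cartesian_product)
  also have "\<dots> = (\<Sum>(i, k)\<in>{(i, k). i + k \<le> ?N}. h i k)"
    by (rule sum.mono_neutral_right)
      (auto simp: h_def not_le intro!: tcoeff_power_eq_0[OF S])
  also have "\<dots> = (\<Sum>n\<le>?N. \<Sum>i\<le>n. h i (n - i))"
    by (rule sum.triangle_reindex_eq)
  also have "\<dots> = tcoeff (tensor_subst (F * G) S) w"
    unfolding tensor_subst_def tcoeff_Tensor_series
    by (intro sum.cong refl) (simp add: h_def fps_mult_nth sum_distrib_right atMost_atLeast0)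
  finally show "tcoeff (tensor_subst (F * G) S) w = tcoeff (tensor_subst F S * tensor_subst G S) w" ..
qed

lemma tensor_subst_one: "tensor_subst 1 S = 1"
  by (rule tensor_series_eqI)
    (simp add: tensor_subst_def tcoeff_one if_distrib[of "\<lambda>x. x * _"] cong: if_cong)

lemma tensor_subst_power:
  assumes "tcoeff S [] = 0"
  shows "tensor_subst (F ^ r) S = tensor_subst F S ^ r"
  by (induction r) (simp_all add: tensor_subst_one tensor_subst_mult[OF assms])

lemma fps_exp_compose_ln: "fps_exp 1 oo fps_ln 1 = (1 + fps_X :: real fps)"
proof -
  have "(fps_exp 1 - 1) oo fps_ln 1 = (fps_X :: real fps)"
    by (simp add: fps_ln_fps_exp_inv fps_inv_fps_exp_compose)
  then show ?thesis by (simp add: fps_compose_sub_distrib diff_eq_eq add.commute)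
qed

lemma tensor_log_eq_subst:
  assumes X: "tcoeff X [] = 1"
  shows "tensor_log X = tensor_subst (fps_ln 1) (X - 1)"
proof (rule tensor_series_eqI)
  fix w :: "'a list"
  have S: "tcoeff (X - 1) [] = 0" by (simp add: X minus_tensor_series_def tcoeff_one)
  have "tcoeff (tensor_log X) w = (\<Sum>k. (- 1) ^ k / real (Suc k) * tcoeff ((X - 1) ^ Suc k) w)"
    by (simp add: tensor_log_def scaleR_tensor_series_def del: power_Suc)
  also have "\<dots> = (\<Sum>k<length w. (- 1) ^ k / real (Suc k) * tcoeff ((X - 1) ^ Suc k) w)"
    by (rule suminf_finite) (use tcoeff_power_eq_0[OF S] in \<open>auto simp del: power_Suc\<close>)
  also have "\<dots> = tcoeff (tensor_subst (fps_ln 1) (X - 1)) w"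
    unfolding tensor_subst_def tcoeff_Tensor_series
    by (simp add: sum.atMost_shift fps_ln_nth del: power_Suc)
  finally show "tcoeff (tensor_log X) w = tcoeff (tensor_subst (fps_ln 1) (X - 1)) w" .
qed

text \<open>
  The series \<open>exp (log X) = X\<close>, read off at one word.  The sum stops at the length of the word because
  \<open>log X\<close> has zero constant term.
\<close>
theorem tcoeff_eq_exp_tensor_log:
  assumes X: "tcoeff X [] = 1"
  shows "tcoeff X w = (\<Sum>r\<le>length w. tcoeff (tensor_log X ^ r) w / fact r)"
proof -
  define S where "S = X - 1"
  have S: "tcoeff S [] = 0" by (simp add: S_def X minus_tensor_series_def tcoeff_one)
  let ?N = "length w" and ?ln = "fps_ln 1 :: real fps"
  have "(\<Sum>r\<le>?N. tcoeff (tensor_log X ^ r) w / fact r)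
      = (\<Sum>r\<le>?N. \<Sum>n\<le>?N. fps_nth (fps_exp 1) r * fps_nth (?ln ^ r) n * tcoeff (S ^ n) w)"
    unfolding tensor_log_eq_subst[OF X] S_def[symmetric] tensor_subst_power[OF S, symmetric]
    unfolding tensor_subst_def tcoeff_Tensor_series
    by (simp add: sum_divide_distrib)
  also have "\<dots> = (\<Sum>n\<le>?N. (\<Sum>r\<le>?N. fps_nth (fps_exp 1) r * fps_nth (?ln ^ r) n) * tcoeff (S ^ n) w)"
    unfolding sum_distrib_right by (rule sum.swap)
  also have "\<dots> = (\<Sum>n\<le>?N. fps_nth (fps_exp 1 oo ?ln) n * tcoeff (S ^ n) w)"
  proof (intro sum.cong refl arg_cong2[where f = "(*)"])
    fix n assume "n \<in> {..?N}"
    then show "(\<Sum>r\<le>?N. fps_nth (fps_exp 1) r * fps_nth (?ln ^ r) n) = fps_nth (fps_exp 1 oo ?ln) n"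
      unfolding fps_compose_nth
      by (intro sum.mono_neutral_right) (auto simp: startsby_zero_power_prefix)
  qed
  also have "\<dots> = tcoeff (tensor_subst (1 + fps_X) S) w"
    by (simp add: fps_exp_compose_ln tensor_subst_def)
  \<comment> \<open>One summand more, so that \<open>n = 1\<close> is within the range also for the empty word.\<close>
  also have "\<dots> = (\<Sum>n\<le>Suc ?N. fps_nth (1 + fps_X) n * tcoeff (S ^ n) w)"
    by (rule tcoeff_tensor_subst[OF S]) simp
  also have "\<dots> = (\<Sum>n\<in>{0, 1}. fps_nth (1 + fps_X) n * tcoeff (S ^ n) w)"
    by (rule sum.mono_neutral_right) auto
  also have "\<dots> = tcoeff (1 + S) w" by (simp add: plus_tensor_series_def)
  finally show ?thesis by (simp add: S_def)
qed


section \<open>Words read along a cycle\<close>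

text \<open>
  The word collected in \<open>k\<close> steps along the cycle whose edges carry the letters of \<open>u\<close>, starting at
  state \<open>i\<close>.
\<close>
definition cyclic_word :: "'d list \<Rightarrow> nat \<Rightarrow> nat \<Rightarrow> 'd list"
  where "cyclic_word u i k = map (\<lambda>l. u ! ((i + l) mod length u)) [0..<k]"

lemma length_cyclic_word [simp]: "length (cyclic_word u i k) = k"
  by (simp add: cyclic_word_def)

lemma cyclic_word_mod: "cyclic_word u (i mod length u) k = cyclic_word u i k"
  by (simp add: cyclic_word_def mod_add_left_eq)

lemma take_cyclic_word: "a \<le> k \<Longrightarrow> take a (cyclic_word u i k) = cyclic_word u i a"
  by (simp add: cyclic_word_def take_map)

lemma drop_cyclic_word: "drop a (cyclic_word u i k) = cyclic_word u (i + a) (k - a)"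
  by (rule nth_equalityI) (auto simp: cyclic_word_def add.assoc)

lemma cyclic_word_self: "cyclic_word u 0 (length u) = u"
  by (rule nth_equalityI) (auto simp: cyclic_word_def)

lemma tcoeff_power_cyclic_word:
  "tcoeff (P ^ Suc r) (cyclic_word u 0 n)
    = (\<Sum>k\<le>n. tcoeff (P ^ r) (cyclic_word u 0 (n - k)) * tcoeff P (cyclic_word u (n - k) k))"
proof -
  have "tcoeff (P ^ Suc r) (cyclic_word u 0 n)
      = (\<Sum>a\<le>n. tcoeff (P ^ r) (cyclic_word u 0 a) * tcoeff P (cyclic_word u a (n - a)))"
    unfolding power_Suc2 tcoeff_times
    by (auto simp: take_cyclic_word drop_cyclic_word intro!: sum.cong)
  also have "\<dots> = (\<Sum>k\<le>n. tcoeff (P ^ r) (cyclic_word u 0 (n - k)) * tcoeff P (cyclic_word u (n - k) k))"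
    by (rule sum.reindex_bij_witness[of _ "\<lambda>k. n - k" "\<lambda>k. n - k"]) auto
  finally show ?thesis .
qed

text \<open>
  A walk of \<open>n\<close> steps from state \<open>0\<close> passes the last edge of the cycle \<open>n div m\<close> times.  If that edge has
  weight \<open>\<sigma>\<close>, the weight of the walk is the product of the weights of its first \<open>n - k\<close> and its
  last \<open>k\<close> steps, and the latter depends on the first part only through the state reached.
\<close>
lemma crossing_sign_add:
  fixes \<sigma> :: real
  assumes "k \<le> n"
  shows "\<sigma> ^ (n div m) = \<sigma> ^ ((n - k) div m) * \<sigma> ^ (((n - k) mod m + k) div m)"
proof -
  have "n = ((n - k) mod m + k) + (n - k) div m * m"
    using assms by (simp add: algebra_simps)
  then have "n div m = (((n - k) mod m + k) + (n - k) div m * m) div m" by (rule arg_cong)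
  also have "\<dots> = (n - k) div m + ((n - k) mod m + k) div m"
    by (cases "m = 0") (simp, rule div_mult_self1)
  finally show ?thesis by (simp add: power_add)
qed


section \<open>Growth of linear systems close to a diagonal one\<close>

text \<open>
  Consider \<open>V = \<Sum> q\<^sub>j x\<^sub>j\<^sup>2\<close> where \<open>q\<^sub>j\<close> is the sign of \<open>D\<^sub>j - \<theta>\<close>.  For the diagonal system \<open>x\<^sub>j' = D\<^sub>j x\<^sub>j\<close> one
  has \<open>V' - 2 \<theta> V = 2 \<Sum> \<bar>D\<^sub>j - \<theta>\<bar> x\<^sub>j\<^sup>2\<close>, and the gap between the \<open>D\<^sub>j\<close> and \<open>\<theta>\<close> leaves room for
  the perturbation.  Hence \<open>V\<close> grows at least like \<open>exp (2 \<theta> t)\<close>, and \<open>V \<le> \<Sum> x\<^sub>j\<^sup>2\<close>.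
\<close>
lemma linear_ode_growth:
  fixes x :: "nat \<Rightarrow> real \<Rightarrow> real" and M :: "nat \<Rightarrow> nat \<Rightarrow> real"
  assumes "m > 0"
    and ode: "\<And>j t. j < m \<Longrightarrow> (x j has_real_derivative (\<Sum>i<m. x i t * M i j)) (at t)"
    and init: "\<And>j. j < m \<Longrightarrow> x j 0 = of_bool (j = 0)"
    and near: "\<And>i j. i < m \<Longrightarrow> j < m \<Longrightarrow> \<bar>M i j - of_bool (i = j) * D j\<bar> \<le> E"
    and gap: "\<And>j. j < m \<Longrightarrow> \<bar>D j - \<theta>\<bar> \<ge> real m * E"
    and "D 0 > \<theta>"
  shows "exp (2 * \<theta>) \<le> (\<Sum>j<m. (x j 1)\<^sup>2)"
proof -
  define q where "q j = (if D j > \<theta> then 1 else - 1 :: real)" for j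
  define V where "V t = (\<Sum>j<m. q j * (x j t)\<^sup>2)" for t
  define V' where "V' t = (\<Sum>j<m. q j * (2 * x j t * (\<Sum>i<m. x i t * M i j)))" for t
  have V': "(V has_real_derivative V' t) (at t)" for t
    unfolding V_def V'_def
    by (auto intro!: derivative_eq_intros ode sum.cong simp: power2_eq_square)
  have ineq: "2 * \<theta> * V t \<le> V' t" for t
  proof -
    let ?X = "\<Sum>j<m. (x j t)\<^sup>2"
    have "(\<Sum>j<m. \<Sum>i<m. \<bar>x j t\<bar> * \<bar>x i t\<bar>) \<le> (\<Sum>j<m. \<Sum>i<m. ((x j t)\<^sup>2 + (x i t)\<^sup>2) / 2)"
    proof (intro sum_mono)
      fix i j show "\<bar>x j t\<bar> * \<bar>x i t\<bar> \<le> ((x j t)\<^sup>2 + (x i t)\<^sup>2) / 2"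
        using sum_squares_bound[of "\<bar>x j t\<bar>" "\<bar>x i t\<bar>"] by simp
    qed
    also have "\<dots> = real m * ?X"
      by (simp add: sum.distrib sum_divide_distrib[symmetric] sum_distrib_left[symmetric])
    finally have cross: "(\<Sum>j<m. \<Sum>i<m. \<bar>x j t\<bar> * \<bar>x i t\<bar>) \<le> real m * ?X" .
    have E: "E \<ge> 0" using near[of 0 0] \<open>m > 0\<close> by linarith
    define R where "R = (\<Sum>j<m. \<Sum>i<m. q j * x j t * (x i t * (M i j - of_bool (i = j) * D j)))"
    have "\<bar>R\<bar> \<le> (\<Sum>j<m. \<bar>\<Sum>i<m. q j * x j t * (x i t * (M i j - of_bool (i = j) * D j))\<bar>)"
      unfolding R_def by (rule sum_abs)
    also have "\<dots> \<le> (\<Sum>j<m. \<Sum>i<m. \<bar>q j * x j t * (x i t * (M i j - of_bool (i = j) * D j))\<bar>)"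
      by (intro sum_mono sum_abs)
    also have "\<dots> \<le> (\<Sum>j<m. \<Sum>i<m. E * (\<bar>x j t\<bar> * \<bar>x i t\<bar>))"
    proof (intro sum_mono)
      fix i j assume "i \<in> {..<m}" "j \<in> {..<m}"
      then have "\<bar>x j t\<bar> * \<bar>x i t\<bar> * \<bar>M i j - of_bool (i = j) * D j\<bar> \<le> \<bar>x j t\<bar> * \<bar>x i t\<bar> * E"
        by (intro mult_left_mono near) auto
      moreover have "\<bar>q j\<bar> = 1" by (simp add: q_def)
      ultimately show "\<bar>q j * x j t * (x i t * (M i j - of_bool (i = j) * D j))\<bar> \<le> E * (\<bar>x j t\<bar> * \<bar>x i t\<bar>)"
        unfolding abs_mult by (simp add: mult.assoc mult.commute[of E])
    qed
    also have "\<dots> = E * (\<Sum>j<m. \<Sum>i<m. \<bar>x j t\<bar> * \<bar>x i t\<bar>)" by (simp add: sum_distrib_left)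
    also have "\<dots> \<le> E * (real m * ?X)" by (rule mult_left_mono[OF cross E])
    finally have "- R \<le> (\<Sum>j<m. real m * E * (x j t)\<^sup>2)" 
      by (simp add: sum_distrib_left[symmetric] mult.left_commute mult.assoc)
    also have "\<dots> \<le> (\<Sum>j<m. q j * (D j - \<theta>) * (x j t)\<^sup>2)"
    proof (intro sum_mono mult_right_mono)
      fix j assume "j \<in> {..<m}"
      then show "real m * E \<le> q j * (D j - \<theta>)" using gap[of j] by (auto simp: q_def)
    qed simp
    finally have nonneg: "0 \<le> (\<Sum>j<m. q j * (D j - \<theta>) * (x j t)\<^sup>2) + R" by linarith
    have eq: "V' t - 2 * \<theta> * V t = 2 * ((\<Sum>j<m. q j * (D j - \<theta>) * (x j t)\<^sup>2) + R)"
    proof -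
      have "(\<Sum>i<m. q j * x j t * (x i t * (M i j - of_bool (i = j) * D j)))
          = q j * x j t * (\<Sum>i<m. x i t * M i j) - q j * D j * (x j t)\<^sup>2" if "j < m" for j
      proof -
        have "(\<Sum>i<m. q j * x j t * (x i t * (M i j - of_bool (i = j) * D j)))
          = (\<Sum>i<m. q j * x j t * (x i t * M i j)) - (\<Sum>i<m. if i = j then q j * D j * (x j t)\<^sup>2 else 0)"
          unfolding sum_subtractf[symmetric]
          by (rule sum.cong) (auto simp: algebra_simps power2_eq_square)
        then show ?thesis using that by (simp add: sum_distrib_left)
      qed
      then have "R = (\<Sum>j<m. q j * x j t * (\<Sum>i<m. x i t * M i j) - q j * D j * (x j t)\<^sup>2)"
        unfolding R_def by (intro sum.cong) auto
      then show ?thesis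
        unfolding V_def V'_def sum_distrib_left sum.distrib[symmetric] sum_subtractf[symmetric]
        by (auto simp: sum_distrib_left sum_subtractf[symmetric] sum.distrib[symmetric] algebra_simps
            intro!: sum.cong)
    qed
    have "0 \<le> V' t - 2 * \<theta> * V t" unfolding eq using nonneg by simp
    then show ?thesis by simp
  qed
  \<comment> \<open>The integrating factor turns the differential inequality into monotonicity.\<close>
  let ?W = "\<lambda>t. V t * exp (- 2 * \<theta> * t)"
  have "?W 0 \<le> ?W 1"
  proof (rule DERIV_nonneg_imp_nondecreasing[where f = ?W])
    fix t :: real
    have "(?W has_real_derivative (V' t - 2 * \<theta> * V t) * exp (- 2 * \<theta> * t)) (at t)"
      by (auto intro!: derivative_eq_intros V' simp: algebra_simps)
    then show "\<exists>y. (?W has_real_derivative y) (at t) \<and> y \<ge> 0"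
      using ineq[of t] by (intro exI conjI) auto
  qed simp
  moreover have "V 0 = 1"
  proof -
    have "V 0 = (\<Sum>j<m. if j = 0 then q 0 else 0)"
      unfolding V_def by (rule sum.cong) (auto simp: init)
    then show ?thesis using \<open>m > 0\<close> \<open>D 0 > \<theta>\<close> by (simp add: q_def)
  qed
  ultimately have "exp (2 * \<theta>) \<le> V 1" by (simp add: exp_minus field_simps)
  also have "\<dots> \<le> (\<Sum>j<m. (x j 1)\<^sup>2)"
    unfolding V_def by (intro sum_mono) (auto simp: q_def)
  finally show ?thesis .
qed

text \<open>
  If \<open>y r = y 0 M\<^sup>r\<close> in the sense of the recursion, the series is the row vector \<open>y 0 exp (t M)\<close>.
\<close>
lemma exp_series_linear_ode:
  fixes y :: "nat \<Rightarrow> nat \<Rightarrow> real" and M :: "nat \<Rightarrow> nat \<Rightarrow> real"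
  assumes rec: "\<And>r j. j < m \<Longrightarrow> y (Suc r) j = (\<Sum>i<m. y r i * M i j)"
    and bound: "\<And>r j. j < m \<Longrightarrow> \<bar>y r j\<bar> \<le> K ^ r"
    and "j < m"
  shows "((\<lambda>t. \<Sum>r. y r j / fact r * t ^ r) has_real_derivative
      (\<Sum>i<m. (\<Sum>r. y r i / fact r * t ^ r) * M i j)) (at t)"
proof -
  have summ: "summable (\<lambda>r. y r j / fact r * t ^ r)" if "j < m" for j t
  proof (rule summable_comparison_test)
    show "summable (\<lambda>r. (K * \<bar>t\<bar>) ^ r /\<^sub>R fact r)" by (rule summable_exp_generic)
    show "\<exists>N. \<forall>r\<ge>N. norm (y r j / fact r * t ^ r) \<le> (K * \<bar>t\<bar>) ^ r /\<^sub>R fact r"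
      using mult_right_mono[OF bound[OF that], of "\<bar>t\<bar> ^ _"]
      by (auto simp: abs_mult power_abs power_mult_distrib divide_simps)
  qed
  have "((\<lambda>t. \<Sum>r. y r j / fact r * t ^ r) has_real_derivative
      (\<Sum>r. diffs (\<lambda>r. y r j / fact r) r * t ^ r)) (at t)"
    by (rule termdiffs_strong_converges_everywhere[OF summ[OF \<open>j < m\<close>]])
  moreover have "(\<Sum>r. diffs (\<lambda>r. y r j / fact r) r * t ^ r)
      = (\<Sum>r. \<Sum>i<m. y r i / fact r * t ^ r * M i j)"
  proof (rule suminf_cong)
    fix r
    have *: "diffs (\<lambda>r. y r j / fact r) r = y (Suc r) j / fact r"
      by (simp add: diffs_def fact_Suc del: of_nat_Suc)
    show "diffs (\<lambda>r. y r j / fact r) r * t ^ r = (\<Sum>i<m. y r i / fact r * t ^ r * M i j)"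
      unfolding * rec[OF \<open>j < m\<close>] sum_divide_distrib sum_distrib_right by (simp add: mult_ac)
  qed
  moreover have "\<dots> = (\<Sum>i<m. \<Sum>r. y r i / fact r * t ^ r * M i j)"
    by (rule suminf_sum) (intro summable_mult2 summ, simp)
  moreover have "\<dots> = (\<Sum>i<m. (\<Sum>r. y r i / fact r * t ^ r) * M i j)"
    by (rule sum.cong[OF refl]) (rule suminf_mult2[OF summ, symmetric], simp)
  ultimately show ?thesis by simp
qed


section \<open>Exponential growth of weighted walks on a cycle\<close>

lemma sum_antidiagonals:
  fixes c :: "nat \<Rightarrow> nat \<Rightarrow> 'a::comm_monoid_add"
  assumes "\<And>i k. A < i \<or> B < k \<Longrightarrow> c i k = 0"
  shows "(\<Sum>n\<le>A + B. \<Sum>k\<le>n. c (n - k) k) = (\<Sum>i\<le>A. \<Sum>k\<le>B. c i k)"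
proof -
  have "(\<Sum>n\<le>A + B. \<Sum>k\<le>n. c (n - k) k) = (\<Sum>(k, i)\<in>{(k, i). k + i \<le> A + B}. c i k)"
    by (rule sum.triangle_reindex_eq[symmetric])
  also have "\<dots> = (\<Sum>(k, i)\<in>{..B} \<times> {..A}. c i k)"
  proof (rule sum.mono_neutral_right)
    show "finite {(k, i). k + i \<le> A + B}"
      by (rule finite_subset[of _ "{..A + B} \<times> {..A + B}"]) auto
  qed (auto, (metis assms not_le)+)
  also have "\<dots> = (\<Sum>k\<le>B. \<Sum>i\<le>A. c i k)"
    by (simp add: sum.cartesian_product)
  finally show ?thesis by (simp add: sum.swap[of _ "{..A}"])
qed

text \<open>
  Exchange of the order of summation in an absolutely convergent double series whose rows and
  columns are finite.
\<close>
lemma suminf_swap_abs: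
  fixes f :: "nat \<Rightarrow> nat \<Rightarrow> real"
  assumes fin: "\<And>r n. n > N r \<Longrightarrow> f r n = 0"
    and fin': "\<And>r n. r > n \<Longrightarrow> f r n = 0"
    and summ: "summable (\<lambda>r. \<Sum>n\<le>N r. \<bar>f r n\<bar>)"
  shows "(\<lambda>n. \<Sum>r\<le>n. f r n) sums (\<Sum>r. \<Sum>n\<le>N r. f r n)"
proof -
  have row: "((\<lambda>n. \<bar>f r n\<bar>) has_sum (\<Sum>n\<le>N r. \<bar>f r n\<bar>)) UNIV" for r
    by (rule has_sum_finite_neutralI[of "{..N r}"]) (simp_all add: fin)
  have row': "((\<lambda>n. f r n) has_sum (\<Sum>n\<le>N r. f r n)) UNIV" for r
    by (rule has_sum_finite_neutralI[of "{..N r}"]) (simp_all add: fin)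
  have col: "((\<lambda>r. f r n) has_sum (\<Sum>r\<le>n. f r n)) UNIV" for n
    by (rule has_sum_finite_neutralI[of "{..n}"]) (simp_all add: fin')
  have "(\<lambda>(r, n). \<bar>f r n\<bar>) summable_on UNIV \<times> UNIV"
  proof (rule summable_on_SigmaI)
    show "((\<lambda>n. case (r, n) of (r, n) \<Rightarrow> \<bar>f r n\<bar>) has_sum (\<Sum>n\<le>N r. \<bar>f r n\<bar>)) UNIV" for r
      using row[of r] by simp
    show "(\<lambda>r. \<Sum>n\<le>N r. \<bar>f r n\<bar>) summable_on UNIV"
      using norm_summable_imp_summable_on[of "\<lambda>r. \<Sum>n\<le>N r. \<bar>f r n\<bar>"] summ by (simp add: sum_nonneg)
  qed auto
  then have "(\<lambda>p. norm (case p of (r, n) \<Rightarrow> f r n)) summable_on UNIV \<times> UNIV"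
    by (simp add: case_prod_unfold)
  then have "(\<lambda>(r, n). f r n) summable_on UNIV \<times> UNIV"
    by (rule abs_summable_summable)
  then obtain T where T: "((\<lambda>(r, n). f r n) has_sum T) (UNIV \<times> UNIV)"
    unfolding summable_on_def ..
  have "((\<lambda>r. \<Sum>n\<le>N r. f r n) has_sum T) UNIV"
    by (rule has_sum_SigmaD[OF T]) (simp add: row')
  moreover have "((\<lambda>(n, r). f r n) has_sum T) (UNIV \<times> UNIV)"
    using has_sum_swap[THEN iffD1, OF T] by simp
  then have "((\<lambda>n. \<Sum>r\<le>n. f r n) has_sum T) UNIV"
    by (rule has_sum_SigmaD) (simp add: col)
  ultimately have "(\<lambda>n. \<Sum>r\<le>n. f r n) sums T" "(\<lambda>r. \<Sum>n\<le>N r. f r n) sums T"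
    by (auto intro: has_sum_imp_sums)
  then show ?thesis by (simp add: sums_iff)
qed

text \<open>
  Think of \<open>c i k\<close> as the weight of a jump of \<open>k\<close> steps from state \<open>i\<close> of a cycle of length \<open>m\<close>, and of
  \<open>A r n\<close> as the total weight of the walks from state \<open>0\<close> that cover \<open>n\<close> steps in \<open>r\<close> jumps.  With an
  additional factor \<open>\<lambda>\<close> for each step the jumps form an \<open>m \<times> m\<close> matrix \<open>M\<close>, in which the jumps of
  full length \<open>m\<close> dominate and are diagonal.  The sums of \<open>\<lambda>\<^sup>n A r n / r!\<close> over all \<open>r\<close> and all \<open>n\<close>
  in a residue class modulo \<open>m\<close> form the row of \<open>exp M\<close> that belongs to state \<open>0\<close>.  Summing over \<open>r\<close>
  first bounds it by \<open>exp (L \<lambda>)\<close>; summing over \<open>n\<close> first exhibits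
  it as the value at time \<open>1\<close> of a solution of \<open>x' = x M\<close>, which is of size at least \<open>exp (\<theta> \<lambda>\<^sup>m)\<close>.
\<close>
lemma cyclic_walk_exp_growth:
  fixes A :: "nat \<Rightarrow> nat \<Rightarrow> real" and c :: "nat \<Rightarrow> nat \<Rightarrow> real"
  assumes m: "m \<ge> 2"
    and periodic: "\<And>i k. c (i mod m) k = c i k"
    and degree: "\<And>i k. k > m \<Longrightarrow> c i k = 0"
    and A0: "\<And>n. A 0 n = of_bool (n = 0)"
    and A_Suc: "\<And>r n. A (Suc r) n = (\<Sum>k\<le>n. A r (n - k) * c (n - k) k)"
    and A_low: "\<And>r n. r > n \<Longrightarrow> A r n = 0"
    and pos: "c 0 m > 0"
    and L: "L \<ge> 0" and bound: "\<And>n. \<bar>\<Sum>r\<le>n. A r n / fact r\<bar> \<le> L ^ n / fact n"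
  shows False
proof -
  have A_high: "A r n = 0" if "n > r * m" for r n
    using that
  proof (induction r arbitrary: n)
    case (Suc r)
    have "A r (n - k) * c (n - k) k = 0" if "k \<le> n" for k
      using Suc that degree[of k] by (cases "k > m") auto
    then show ?case unfolding A_Suc by (intro sum.neutral) simp
  qed (simp add: A0)
  \<comment> \<open>The threshold must lie below the diagonal entry of state \<open>0\<close> and keep a distance \<open>\<eta>\<close> from all
    diagonal entries.\<close>
  obtain \<theta> where \<theta>: "0 < \<theta>" "\<theta> < c 0 m" "\<theta> \<notin> (\<lambda>j. c j m) ` {..<m}"
  proof -
    have "infinite ({0<..<c 0 m} - (\<lambda>j. c j m) ` {..<m})"
      by (rule Diff_infinite_finite) (use pos in \<open>auto simp: infinite_Ioo\<close>)
    then obtain x where "x \<in> {0<..<c 0 m} - (\<lambda>j. c j m) ` {..<m}"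
      using infinite_imp_nonempty by blast
    then show thesis using that by auto
  qed
  obtain \<eta> where \<eta>: "\<eta> > 0" "\<And>j. j < m \<Longrightarrow> \<bar>c j m - \<theta>\<bar> \<ge> \<eta>"
  proof
    show "Min ((\<lambda>j. \<bar>c j m - \<theta>\<bar>) ` {..<m}) > 0"
      using m \<theta>(3) by (subst Min_gr_iff) (auto simp: lessThan_empty_iff)
    show "\<And>j. j < m \<Longrightarrow> \<bar>c j m - \<theta>\<bar> \<ge> Min ((\<lambda>j. \<bar>c j m - \<theta>\<bar>) ` {..<m})"
      by (rule Min_le) auto
  qed
  define B where "B = (\<Sum>i<m. \<Sum>k<m. \<bar>c i k\<bar>)"
  \<comment> \<open>The second summand makes the gap \<open>\<lambda>\<^sup>m \<eta>\<close> exceed the perturbation \<open>m \<lambda>\<^bsup>m-1\<^esup> B\<close>, and the third makes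
    \<open>\<theta> \<lambda>\<^sup>m\<close> exceed \<open>m + L \<lambda>\<close>.\<close>
  define lam where "lam = 1 + real m * B / \<eta> + (real m + L) / \<theta>"
  have B: "B \<ge> 0" by (simp add: B_def sum_nonneg)
  have lam1: "lam \<ge> 1" using B \<eta>(1) \<theta>(1) L by (simp add: lam_def)
  have "lam > real m * B / \<eta>" using L \<theta>(1) by (simp add: lam_def add_pos_nonneg)
  then have lamB: "real m * B \<le> lam * \<eta>" using \<eta>(1) by (simp add: field_simps)
  have "lam > (real m + L) / \<theta>" using B \<eta>(1) by (simp add: lam_def add_pos_nonneg)
  then have lam\<theta>: "real m + L < lam * \<theta>" using \<theta>(1) by (simp add: field_simps)

  \<comment> \<open>\<open>y r\<close> is the row of \<open>M\<^sup>r\<close> that belongs to state \<open>0\<close>, and \<open>T\<close> is an absolute bound for it.\<close>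
  define M where "M i j = (\<Sum>k\<le>m. of_bool ((i + k) mod m = j) * lam ^ k * c i k)" for i j
  define y where "y r j = (\<Sum>n\<le>r * m. of_bool (n mod m = j) * lam ^ n * A r n)" for r j
  define T where "T r = (\<Sum>n\<le>r * m. lam ^ n * \<bar>A r n\<bar>)" for r
  define K where "K = (\<Sum>i<m. \<Sum>k\<le>m. lam ^ k * \<bar>c i k\<bar>)"
  define x where "x j t = (\<Sum>r. y r j / fact r * t ^ r)" for j t
  have M_mod: "M (i mod m) j = M i j" for i j
    by (simp add: M_def periodic mod_add_left_eq)

  have y_Suc: "y (Suc r) j = (\<Sum>i<m. y r i * M i j)" if "j < m" for r j
  proof -
    let ?g = "\<lambda>i k. of_bool ((i + k) mod m = j) * lam ^ (i + k) * (A r i * c i k)"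
    have "y (Suc r) j = (\<Sum>n\<le>r * m + m. \<Sum>k\<le>n. ?g (n - k) k)"
      unfolding y_def A_Suc sum_distrib_left by (intro sum.cong) (auto simp: add.commute)
    also have "\<dots> = (\<Sum>n\<le>r * m. \<Sum>k\<le>m. ?g n k)"
      by (rule sum_antidiagonals) (auto simp: A_high degree)
    also have "\<dots> = (\<Sum>n\<le>r * m. lam ^ n * A r n * M n j)"
      by (simp add: M_def sum_distrib_left power_add mult_ac)
    also have "\<dots> = (\<Sum>n\<le>r * m. \<Sum>i<m. of_bool (n mod m = i) * lam ^ n * A r n * M i j)"
    proof (rule sum.cong[OF refl])
      fix n
      have "(\<Sum>i<m. of_bool (n mod m = i) * lam ^ n * A r n * M i j)
          = (\<Sum>i<m. if n mod m = i then lam ^ n * A r n * M n j else 0)"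
        by (rule sum.cong) (auto simp: M_mod)
      then show "lam ^ n * A r n * M n j = (\<Sum>i<m. of_bool (n mod m = i) * lam ^ n * A r n * M i j)"
        using m by simp
    qed
    also have "\<dots> = (\<Sum>i<m. y r i * M i j)"
      by (subst sum.swap) (simp add: y_def sum_distrib_right)
    finally show ?thesis .
  qed
  have T_Suc: "T (Suc r) \<le> T r * K" for r
  proof -
    let ?g = "\<lambda>i k. lam ^ i * \<bar>A r i\<bar> * (lam ^ k * \<bar>c i k\<bar>)"
    have "T (Suc r) \<le> (\<Sum>n\<le>r * m + m. \<Sum>k\<le>n. ?g (n - k) k)"
      unfolding T_def mult_Suc add.commute[of m]
    proof (rule sum_mono)
      fix n
      have "lam ^ n * \<bar>A (Suc r) n\<bar> \<le> lam ^ n * (\<Sum>k\<le>n. \<bar>A r (n - k) * c (n - k) k\<bar>)"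
        unfolding A_Suc using lam1 by (intro mult_left_mono sum_abs) auto
      also have "\<dots> = (\<Sum>k\<le>n. ?g (n - k) k)"
        unfolding sum_distrib_left
      proof (rule sum.cong[OF refl])
        fix k assume "k \<in> {..n}"
        then have "lam ^ n = lam ^ (n - k) * lam ^ k" by (simp flip: power_add)
        then show "lam ^ n * \<bar>A r (n - k) * c (n - k) k\<bar> = ?g (n - k) k"
          by (simp add: abs_mult mult_ac)
      qed
      finally show "lam ^ n * \<bar>A (Suc r) n\<bar> \<le> (\<Sum>k\<le>n. ?g (n - k) k)" .
    qed
    also have "\<dots> = (\<Sum>n\<le>r * m. \<Sum>k\<le>m. ?g n k)"
      by (rule sum_antidiagonals) (auto simp: A_high degree)
    also have "\<dots> = (\<Sum>n\<le>r * m. lam ^ n * \<bar>A r n\<bar> * (\<Sum>k\<le>m. lam ^ k * \<bar>c n k\<bar>))"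
      by (simp add: sum_distrib_left)
    also have "\<dots> \<le> (\<Sum>n\<le>r * m. lam ^ n * \<bar>A r n\<bar> * K)"
    proof (intro sum_mono mult_left_mono)
      fix n
      have "(\<Sum>k\<le>m. lam ^ k * \<bar>c n k\<bar>) = (\<Sum>k\<le>m. lam ^ k * \<bar>c (n mod m) k\<bar>)"
        by (simp add: periodic)
      also have "\<dots> \<le> K"
        unfolding K_def using m lam1
        by (intro member_le_sum[of _ _ "\<lambda>i. \<Sum>k\<le>m. lam ^ k * \<bar>c i k\<bar>"] sum_nonneg) auto
      finally show "(\<Sum>k\<le>m. lam ^ k * \<bar>c n k\<bar>) \<le> K" .
    qed (use lam1 in auto)
    finally show ?thesis by (simp add: T_def sum_distrib_right)
  qed
  have K: "K \<ge> 0" using lam1 by (auto simp: K_def intro!: sum_nonneg)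
  have T_le: "T r \<le> K ^ r" for r
  proof (induction r)
    case (Suc r)
    have "T (Suc r) \<le> K ^ r * K" using T_Suc[of r] mult_right_mono[OF Suc K] by linarith
    then show ?case by (simp add: mult.commute)
  qed (simp add: T_def A0)
  have y_le: "\<bar>y r j\<bar> \<le> K ^ r" for r j
  proof -
    have "\<bar>y r j\<bar> \<le> (\<Sum>n\<le>r * m. \<bar>of_bool (n mod m = j) * lam ^ n * A r n\<bar>)"
      unfolding y_def by (rule sum_abs)
    also have "\<dots> \<le> T r"
      unfolding T_def using lam1 by (intro sum_mono) (auto simp: abs_mult)
    finally show ?thesis using T_le[of r] by linarith
  qed

  have "exp (2 * (lam ^ m * \<theta>)) \<le> (\<Sum>j<m. (x j 1)\<^sup>2)"
  proof (rule linear_ode_growth[where M = M and D = "\<lambda>j. lam ^ m * c j m" and E = "lam ^ (m - 1) * B"])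
    show "m > 0" using m by simp
    show "(x j has_real_derivative (\<Sum>i<m. x i t * M i j)) (at t)" if "j < m" for j t
      unfolding x_def by (rule exp_series_linear_ode[where K = K]) (use y_Suc y_le that in auto)
    show "x j 0 = of_bool (j = 0)" if "j < m" for j
    proof -
      have "x j 0 = y 0 j" unfolding x_def
        using powser_zero[of "\<lambda>r. y r j / fact r"] by simp
      then show ?thesis by (simp add: y_def A0)
    qed
    show "\<bar>M i j - of_bool (i = j) * (lam ^ m * c j m)\<bar> \<le> lam ^ (m - 1) * B"
      if "i < m" "j < m" for i j
    proof -
      have "M i j = (\<Sum>k<m. of_bool ((i + k) mod m = j) * lam ^ k * c i k) + of_bool (i = j) * (lam ^ m * c j m)"
        unfolding M_def lessThan_Suc_atMost[symmetric] using that by auto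
      then have "\<bar>M i j - of_bool (i = j) * (lam ^ m * c j m)\<bar>
          = \<bar>\<Sum>k<m. of_bool ((i + k) mod m = j) * lam ^ k * c i k\<bar>" by simp
      also have "\<dots> \<le> (\<Sum>k<m. \<bar>of_bool ((i + k) mod m = j) * lam ^ k * c i k\<bar>)" by (rule sum_abs)
      also have "\<dots> \<le> (\<Sum>k<m. lam ^ (m - 1) * \<bar>c i k\<bar>)"
      proof (rule sum_mono)
        fix k assume "k \<in> {..<m}"
        then have "lam ^ k \<le> lam ^ (m - 1)" using lam1 by (intro power_increasing) auto
        then have "lam ^ k * \<bar>c i k\<bar> \<le> lam ^ (m - 1) * \<bar>c i k\<bar>" by (rule mult_right_mono) simp
        then show "\<bar>of_bool ((i + k) mod m = j) * lam ^ k * c i k\<bar> \<le> lam ^ (m - 1) * \<bar>c i k\<bar>"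
          using lam1 by (auto simp: abs_mult)
      qed
      also have "\<dots> = lam ^ (m - 1) * (\<Sum>k<m. \<bar>c i k\<bar>)" by (simp add: sum_distrib_left)
      also have "\<dots> \<le> lam ^ (m - 1) * B"
        unfolding B_def using that lam1
        by (intro mult_left_mono member_le_sum[of _ _ "\<lambda>i. \<Sum>k<m. \<bar>c i k\<bar>"] sum_nonneg) auto
      finally show ?thesis .
    qed
    have lam_m: "lam ^ m = lam ^ (m - 1) * lam" using m by (cases m) (auto simp: mult.commute)
    show "real m * (lam ^ (m - 1) * B) \<le> \<bar>lam ^ m * c j m - lam ^ m * \<theta>\<bar>" if "j < m" for j
    proof -
      have "real m * (lam ^ (m - 1) * B) = lam ^ (m - 1) * (real m * B)" by simp
      also have "\<dots> \<le> lam ^ (m - 1) * (lam * \<eta>)"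
        using lamB lam1 by (intro mult_left_mono) auto
      also have "\<dots> \<le> lam ^ m * \<bar>c j m - \<theta>\<bar>"
        unfolding lam_m mult.assoc[symmetric] using lam1 \<eta>(2)[OF that] by (intro mult_left_mono) auto
      also have "\<dots> = \<bar>lam ^ m * c j m - lam ^ m * \<theta>\<bar>"
        using lam1 by (simp add: abs_mult right_diff_distrib[symmetric])
      finally show ?thesis .
    qed
    show "lam ^ m * \<theta> < lam ^ m * c 0 m" using lam1 \<theta>(2) by simp
  qed
  also have "\<dots> \<le> (\<Sum>j<m. (exp (L * lam))\<^sup>2)"
  proof (rule sum_mono)
    fix j
    let ?f = "\<lambda>r n. of_bool (n mod m = j) * lam ^ n * A r n / fact r"
    have "(\<lambda>n. \<Sum>r\<le>n. ?f r n) sums (\<Sum>r. \<Sum>n\<le>r * m. ?f r n)"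
    proof (rule suminf_swap_abs)
      show "summable (\<lambda>r. \<Sum>n\<le>r * m. \<bar>?f r n\<bar>)"
      proof (rule summable_comparison_test)
        show "summable (\<lambda>r. K ^ r /\<^sub>R fact r)" by (rule summable_exp_generic)
        have "norm (\<Sum>n\<le>r * m. \<bar>?f r n\<bar>) \<le> K ^ r /\<^sub>R fact r" for r
        proof -
          have "(\<Sum>n\<le>r * m. \<bar>?f r n\<bar>) \<le> (\<Sum>n\<le>r * m. lam ^ n * \<bar>A r n\<bar> / fact r)"
            using lam1 by (intro sum_mono) (auto simp: abs_mult)
          also have "\<dots> = T r / fact r" by (simp add: T_def sum_divide_distrib)
          also have "\<dots> \<le> K ^ r / fact r" using T_le by (intro divide_right_mono) auto
          finally show ?thesis by (simp add: sum_nonneg divide_inverse mult.commute)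
        qed
        then show "\<exists>N. \<forall>r\<ge>N. norm (\<Sum>n\<le>r * m. \<bar>?f r n\<bar>) \<le> K ^ r /\<^sub>R fact r" by blast
      qed
    qed (auto simp: A_high A_low)
    moreover have "(\<Sum>r. \<Sum>n\<le>r * m. ?f r n) = x j 1"
      unfolding x_def y_def by (simp add: sum_divide_distrib)
    ultimately have x1: "(\<lambda>n. \<Sum>r\<le>n. ?f r n) sums x j 1" by simp
    have le: "\<bar>\<Sum>r\<le>n. ?f r n\<bar> \<le> (L * lam) ^ n /\<^sub>R fact n" for n
    proof -
      have "(\<Sum>r\<le>n. ?f r n) = of_bool (n mod m = j) * lam ^ n * (\<Sum>r\<le>n. A r n / fact r)"
        by (simp add: sum_distrib_left)
      also have "\<bar>\<dots>\<bar> \<le> lam ^ n * \<bar>\<Sum>r\<le>n. A r n / fact r\<bar>"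
        using lam1 by (auto simp: abs_mult)
      also have "\<dots> \<le> lam ^ n * (L ^ n / fact n)"
        using lam1 by (intro mult_left_mono bound) auto
      finally show ?thesis by (simp add: power_mult_distrib divide_inverse mult_ac)
    qed
    have "(\<lambda>n. (L * lam) ^ n /\<^sub>R fact n) sums exp (L * lam)" by (rule exp_converges)
    then have "x j 1 \<le> exp (L * lam)" "- x j 1 \<le> exp (L * lam)"
      using sums_le[OF _ x1] sums_le[OF _ sums_minus[OF x1]] le
      by (smt (verit))+
    then have "\<bar>x j 1\<bar> \<le> exp (L * lam)" by linarith
    then show "(x j 1)\<^sup>2 \<le> (exp (L * lam))\<^sup>2"
      by (simp add: abs_le_square_iff[symmetric])
  qed
  also have "\<dots> = real m * exp (2 * (L * lam))"
    by (simp add: exp_double[symmetric])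
  also have "\<dots> \<le> exp (real m) * exp (2 * (L * lam))"
    using order_trans[OF _ exp_ge_add_one_self[of "real m"], of "real m"]
    by (intro mult_right_mono) simp_all
  also have "\<dots> = exp (real m + 2 * (L * lam))" by (simp add: exp_add)
  finally have "2 * (lam ^ m * \<theta>) \<le> real m + 2 * (L * lam)" by simp
  also have "\<dots> \<le> 2 * ((real m + L) * lam)"
    using mult_left_mono[OF lam1, of "real m"] by (simp add: algebra_simps)
  also have "\<dots> < 2 * (lam * \<theta> * lam)"
    using lam\<theta> lam1 by (simp add: mult.commute)
  also have "\<dots> = 2 * (lam ^ 2 * \<theta>)" by (simp add: power2_eq_square)
  also have "\<dots> \<le> 2 * (lam ^ m * \<theta>)"
    using power_increasing[OF m lam1] \<theta>(1) by simp
  finally show False by simp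
qed


section \<open>Log-signatures of rectifiable paths\<close>

text \<open>
  The coefficients of \<open>P\<close> and of the signature along the cyclic words of \<open>u\<close> are the jump weights
  and the walk sums of \<open>cyclic_walk_exp_growth\<close>.
\<close>
theorem log_signature_not_polynomial:
  fixes P :: "('d::finite) tensor_series" and \<gamma> :: "real \<Rightarrow> real ^ 'd"
  assumes const: "tcoeff P [] = 0"
    and degree: "\<And>w. length w > m \<Longrightarrow> tcoeff P w = 0"
    and u: "length u = m" "tcoeff P u \<noteq> 0" and m: "m \<ge> 2"
    and path: "a \<le> b" "rectifiable_on a b \<gamma>"
  shows "log_signature a b \<gamma> \<noteq> P"
proof
  assume log: "log_signature a b \<gamma> = P"
  let ?X = "signature a b \<gamma>"
  obtain L where L: "L \<ge> 0" "\<And>w. \<bar>tcoeff ?X w\<bar> \<le> L ^ length w / fact (length w)"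
    using signature_bound[OF path] by metis
  have X: "tcoeff ?X w = (\<Sum>r\<le>length w. tcoeff (P ^ r) w / fact r)" for w
    using tcoeff_eq_exp_tensor_log[of ?X w] log by (simp add: signature_def log_signature_def)
  define \<sigma> where "\<sigma> = sgn (tcoeff P u)"
  have \<sigma>: "\<bar>\<sigma>\<bar> = 1" using u(2) by (simp add: \<sigma>_def abs_sgn_eq)
  (* The sign sigma sits on the edge from state m - 1 to state 0, so it is counted once for every
     completed turn: a walk of n steps that starts at state i passes it (i + n) div m times. *)
  define c where "c i k = \<sigma> ^ ((i mod m + k) div m) * tcoeff P (cyclic_word u i k)" for i k
  define A where "A r n = \<sigma> ^ (n div m) * tcoeff (P ^ r) (cyclic_word u 0 n)" for r n
  show False
  proof (rule cyclic_walk_exp_growth[OF m, of c A L])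
    show "c (i mod m) k = c i k" for i k
      using cyclic_word_mod[of u i k] by (simp add: c_def u(1))
    show "c i k = 0" if "k > m" for i k
      using degree that by (simp add: c_def)
    show "A 0 n = of_bool (n = 0)" for n
      by (auto simp: A_def tcoeff_one cyclic_word_def)
    show "A (Suc r) n = (\<Sum>k\<le>n. A r (n - k) * c (n - k) k)" for r n
      unfolding A_def c_def tcoeff_power_cyclic_word sum_distrib_left
      by (intro sum.cong refl) (simp add: crossing_sign_add[of _ n \<sigma> m] mult_ac)
    show "A r n = 0" if "r > n" for r n
      using tcoeff_power_eq_0[OF const, of "cyclic_word u 0 n" r] that by (simp add: A_def)
    show "c 0 m > 0"
      using cyclic_word_self[of u] u m by (simp add: c_def \<sigma>_def sgn_if)
    show "L \<ge> 0" by (rule L(1))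
    show "\<bar>\<Sum>r\<le>n. A r n / fact r\<bar> \<le> L ^ n / fact n" for n
    proof -
      have "(\<Sum>r\<le>n. A r n / fact r) = \<sigma> ^ (n div m) * tcoeff ?X (cyclic_word u 0 n)"
        by (simp add: X A_def sum_distrib_left)
      then show ?thesis using L(2)[of "cyclic_word u 0 n"] \<sigma> by (simp add: abs_mult power_abs)
    qed
  qed
qed

theorem corollary5p1:
  fixes P :: "('d::finite) tensor_series" and m :: nat
  assumes "P \<in> lie_polynomials" and "P \<noteq> 0" and "tensor_degree P = m" and "m \<ge> 2"
  shows "\<not> (\<exists>(t\<^sub>0::real) (t\<^sub>1::real) (\<gamma> :: real \<Rightarrow> real ^ 'd).
           t\<^sub>0 < t\<^sub>1 \<and> rectifiable_on t\<^sub>0 t\<^sub>1 \<gamma> \<and> log_signature t\<^sub>0 t\<^sub>1 \<gamma> = P)"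
proof -
  let ?D = "{k. level k P \<noteq> 0}"
  have zero_iff: "level k P = 0 \<longleftrightarrow> (\<forall>w. length w = k \<longrightarrow> tcoeff P w = 0)" for k
    by (auto simp: level_def zero_tensor_series_def Tensor_series_inject fun_eq_iff)
  have fin: "finite ?D" and "level 0 P = 0"
    using assms(1) by (simp_all add: lie_polynomials_def lie_series_def)
  then have const: "tcoeff P [] = 0" by (simp add: zero_iff)
  obtain w where "tcoeff P w \<noteq> 0"
    using assms(2) tensor_series_eqI[of P 0] by (auto simp: zero_tensor_series_def)
  then have "?D \<noteq> {}" by (auto simp: zero_iff)
  then have "m \<in> ?D" and max: "\<And>k. k \<in> ?D \<Longrightarrow> k \<le> m"
    using Max_in[OF fin] Max_ge[OF fin] assms(3) by (auto simp: tensor_degree_def)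
  then obtain u where u: "length u = m" "tcoeff P u \<noteq> 0" by (auto simp: zero_iff)
  have degree: "tcoeff P w = 0" if "length w > m" for w
    using max[of "length w"] that by (auto simp: zero_iff)
  have "log_signature a b \<gamma> \<noteq> P" if "a < b" "rectifiable_on a b \<gamma>" for a b \<gamma>
    by (rule log_signature_not_polynomial[OF const degree u assms(4)]) (use that in auto)
  then show ?thesis by blast
qed

end
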